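(* Let $a,b$ be integers with $2\le a\le b-2$ and $(a,b)\ne(2,4)$, let $\rho$ be a root of the polynomial $x^3-(a+b)x^2+abx-1$, and write $b-a=2L+l_0$ with $L\in\mathbb Z$ and $l_0\in\{0,1\}$. If $\alpha$ is indecomposable in $\mathbb Z[\rho]$, then: \begin{enumerate} \item if $l_0=0$ and $1\le L\le a-2$, then $N(\alpha)\le L^2a^3+(2L^3+L^2+1)a^2-(2L^3+3L^2+L)a+L^3+L^2$; \item if $l_0=1$ and $1\le L\le a+1$, then $N(\alpha)\le (L^2+L)a^3+(2L^3+4L^2+3L+3)a^2-(2L^3+6L^2+5L+3)a+L^3+3L^2+2L+1$. \end{enumerate}
   Context: The field $K=\mathbb Q(\rho)$ is a totally real cubic field and $\mathbb Z[\rho]$ is an order in it. An element of $K$ is totally positive if all its images under the embeddings $K\to\mathbb R$ are positive. A totally positive $\alpha\in\mathbb Z[\rho]$ is indecomposable in $\mathbb Z[\rho]$ if it cannot be written as $\alpha=\beta+\gamma$ with $\beta,\gamma\in\mathbb Z[\rho]$ totally positive. $N$ denotes the norm from $K$ to $\mathbb Q$. *)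

theory Defs
  imports "HOL-Computational_Algebra.Computational_Algebra" "HOL-Library.FuncSet" Complex_Main
begin

definition is_subfield :: "'a::field set \<Rightarrow> bool" where
  "is_subfield F \<longleftrightarrow> 0 \<in> F \<and> 1 \<in> F \<and> (\<forall>x\<in>F. \<forall>y\<in>F. x + y \<in> F \<and> x * y \<in> F) \<and>
     (\<forall>x\<in>F. - x \<in> F \<and> inverse x \<in> F)"

(* In characteristic 0 the smallest subfield containing r contains the rationals, so this is Q(r). *)
definition rat_adjoin :: "'a::field_char_0 \<Rightarrow> 'a set" where
  "rat_adjoin r = \<Inter>{F. is_subfield F \<and> r \<in> F}"

definition int_adjoin :: "'a::field_char_0 \<Rightarrow> 'a set" where
  "int_adjoin r = range (\<lambda>p :: int poly. poly (map_poly of_int p) r)"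

(* Extensionality makes each homomorphism K -> 'b a single HOL function, so that products over
   the set of embeddings have one factor per homomorphism. *)
definition field_embeddings :: "'a::field set \<Rightarrow> ('a \<Rightarrow> 'b::field) set" where
  "field_embeddings K = {s \<in> extensional K. s 1 = 1 \<and>
     (\<forall>x\<in>K. \<forall>y\<in>K. s (x + y) = s x + s y \<and> s (x * y) = s x * s y)}"

definition totally_positive :: "'a::field set \<Rightarrow> 'a \<Rightarrow> bool" where
  "totally_positive K x \<longleftrightarrow>
     x \<in> K \<and> (\<forall>s \<in> (field_embeddings K :: ('a \<Rightarrow> real) set). s x > 0)"

definition indecomposable_in :: "'a::field set \<Rightarrow> 'a set \<Rightarrow> 'a \<Rightarrow> bool" where
  "indecomposable_in K R x \<longleftrightarrow> x \<in> R \<and> totally_positive K x \<and>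
     \<not> (\<exists>y\<in>R. \<exists>z\<in>R. totally_positive K y \<and> totally_positive K z \<and> x = y + z)"

(* For a number field K the product of the conjugates is rational; it is read back as the unique
   rational with that complex value. *)
definition field_norm :: "'a::field_char_0 set \<Rightarrow> 'a \<Rightarrow> rat" where
  "field_norm K x =
     (THE q. of_rat q = (\<Prod>s \<in> (field_embeddings K :: ('a \<Rightarrow> complex) set). s x))"

end

theory Submission
  imports Defs
begin

text \<open>
  Write \<open>m = b - a\<close> and \<open>\<epsilon> = (\<rho> - a)\<^sup>2\<close>. Up to multiplication by the totally positive units
  \<open>\<rho>\<close> and \<open>\<epsilon>\<close>, every totally positive element lies in one of the cones spanned by \<open>1, \<rho>, \<rho>\<epsilon>\<close> and
  by \<open>1, \<epsilon>, \<rho>\<epsilon>\<close>: among all its unit multiples and both cones, choose the pair for which the linear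
  form equal to 1 on the generators of the cone is smallest; a multiple outside its cone could be
  moved across a face to make this form smaller still. An indecomposable element in one of the cones
  lies in the half-open parallelepiped of its generators or is a generator, hence it is a unit or
  \<open>1 + y \<rho> (\<rho> - a) - k (\<rho> - a)\<close> with \<open>0 \<le> k < a\<close> and \<open>1 \<le> y \<le> m\<close>. On this rectangle the norm is
  largest at \<open>k = a - 1\<close>, \<open>y = L + 1\<close>, where it equals the stated bound.
\<close>

section \<open>The norm on the parallelepiped\<close>

text \<open>\<open>point_norm a m k y\<close> is the norm of \<open>1 + y \<rho> (\<rho> - a) - k (\<rho> - a)\<close> when \<open>m = b - a\<close>.\<close>

definition point_norm :: "int \<Rightarrow> int \<Rightarrow> int \<Rightarrow> int \<Rightarrow> int" where
  "point_norm a m k y =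
     y^3 - (a*k*m + a^2*k + a + 2*m) * y^2 +
     (a*k*m^2 + a^2*k*m + 2*a*k^2 + k^2*m + a*m + m^2 + 3*k) * y -
     k^3 - a*k^2*m + a*k - k*m + 1"

section \<open>Forward differences of the norm on the rectangle\<close>

definition slope_y :: "int \<Rightarrow> int \<Rightarrow> int \<Rightarrow> int \<Rightarrow> int" where
  "slope_y a m k y = point_norm a m k (y + 1) - point_norm a m k y"

definition slope_k :: "int \<Rightarrow> int \<Rightarrow> int \<Rightarrow> int \<Rightarrow> int" where
  "slope_k a m k y = point_norm a m (k + 1) y - point_norm a m k y"

lemma slope_y_eq:
  "slope_y a m k y =
     3*y^2 + 3*y + 1 - (2*y + 1) * (a*k*m + a^2*k + a + 2*m) +
     (a*k*m^2 + a^2*k*m + 2*a*k^2 + k^2*m + a*m + m^2 + 3*k)"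
  unfolding slope_y_def point_norm_def by algebra

lemma slope_k_eq:
  "slope_k a m k y =
     a*(a + m)*(y*(m - y)) + a - m + 3*y + (2*k + 1)*((2*a + m)*y - a*m) - 3*k^2 - 3*k - 1"
  unfolding slope_k_def point_norm_def by algebra

lemma int_decreasing_chain:
  fixes f :: "int \<Rightarrow> int"
  assumes "i \<le> j" "\<And>t. i \<le> t \<Longrightarrow> t < j \<Longrightarrow> f (t + 1) \<le> f t"
  shows "f j \<le> f i"
  using assms
proof (induction j rule: int_ge_induct)
  case (step j)
  then show ?case using order.trans[of "f (j+1)" "f j" "f i"] by simp
qed simp

lemma int_increasing_chain:
  fixes f :: "int \<Rightarrow> int"
  assumes "i \<le> j" "\<And>t. i \<le> t \<Longrightarrow> t < j \<Longrightarrow> f t \<le> f (t + 1)"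
  shows "f i \<le> f j"
  using int_decreasing_chain[of i j "\<lambda>t. - f t"] assms by simp

lemmas polynomial_expand = algebra_simps power2_eq_square power3_eq_cube

text \<open>The terms with \<open>a*k*(a + m)\<close> enter with the factor
  \<open>-(2*y + 1 - m)\<close>, which is at most -2 past the middle and outweighs the rest. In the
  nonnegative variables \<open>s\<close>, \<open>t\<close>, \<open>i\<close>, \<open>j\<close> all
  coefficients of \<open>- slope_y - t^2\<close> are nonnegative; the sign lemmas below use the same
  kind of substitution.\<close>

lemma slope_y_nonpos:
  assumes "2 \<le> m" "1 \<le> k" "k \<le> a - 1" "m + 1 \<le> 2*y" "y < m"
  shows "slope_y a m k y \<le> 0"
proof -
  define s where "s = 2*y - m - 1"
  define j where "j = a - 1 - k"
  define t where "t = y - 2 - s"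
  define i where "i = k - 1"
  have e: "y = s + t + 2" "k = i + 1" "m = s + 2*t + 3" "a = i + j + 2"
    and nonneg: "0 \<le> s" "0 \<le> t" "0 \<le> i" "0 \<le> j"
    using assms by (simp_all add: s_def j_def t_def i_def)
  have "0 \<le> - slope_y a m k y - t^2"
    unfolding slope_y_eq e using nonneg by (simp add: polynomial_expand)
  then show ?thesis using zero_le_power2[of t] by linarith
qed

text \<open>For \<open>y = L + 1\<close> both \<open>y*(m - y)\<close> and
  \<open>(2*a + m)*y - a*m\<close> are nonnegative, and together they absorb the loss
  \<open>3*k^2 + 3*k + 1\<close> because \<open>k \<le> a - 2\<close>.\<close>

lemma slope_k_middle_nonneg:
  assumes "0 \<le> k" "k \<le> a - 2" "1 \<le> L" "m = 2*L \<or> m = 2*L + 1"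
  shows "0 \<le> slope_k a m k (L + 1)"
proof -
  define i j where "i = L - 1" and "j = a - 2 - k"
  have e: "L = i + 1" "a = k + 2 + j" and nonneg: "0 \<le> i" "0 \<le> j"
    using assms by (simp_all add: i_def j_def)
  from assms(4) show ?thesis
    unfolding slope_k_eq e using nonneg assms(1) by (elim disjE) (simp_all add: polynomial_expand)
qed

lemma slope_k_zero_nonneg:
  assumes "2 \<le> a" "1 \<le> y" "y \<le> m"
  shows "0 \<le> slope_k a m 0 y"
proof -
  define i t s where "i = a - 2" and "t = y - 1" and "s = m - y"
  have e: "a = i + 2" "y = t + 1" "m = t + s + 1" and nonneg: "0 \<le> i" "0 \<le> t" "0 \<le> s"
    using assms by (simp_all add: i_def t_def s_def)
  show ?thesis
    unfolding slope_k_eq e using nonneg by (simp add: polynomial_expand)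
qed

lemma slope_y_antimono:
  assumes "2 \<le> a" "1 \<le> k" "0 \<le> m" "y \<le> z" "2*z \<le> m"
  shows "slope_y a m k z \<le> slope_y a m k y"
proof -
  have "slope_y a m k y - slope_y a m k z =
      (z - y) * (2*(a*k*m + a^2*k + a + 2*m) - 3*(y + z) - 3)"
    unfolding slope_y_eq by algebra
  moreover have "0 \<le> 2*(a*k*m + a^2*k + a + 2*m) - 3*(y + z) - 3"
  proof -
    have "0 \<le> a*k*m" "0 \<le> a^2*k" using assms by simp_all
    moreover have "0 \<le> 2 * (p + q + a + 2 * m) - 3 * (y + z) - 3" if "0 \<le> p" "0 \<le> q" for p q
      using that assms by (smt (verit))
    ultimately show ?thesis by blast
  qed
  ultimately show ?thesis
    using assms(4) by (metis diff_ge_0_iff_ge mult_nonneg_nonneg)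
qed

text \<open>Here the upper bounds on \<open>L\<close> enter: they make \<open>L + 1\<close> at least
  as good as \<open>L\<close> in the last row \<open>k = a - 1\<close>.\<close>

lemma slope_y_last_nonneg:
  assumes "2 \<le> a" "1 \<le> L" "(m = 2*L \<and> L \<le> a - 2) \<or> (m = 2*L + 1 \<and> L \<le> a + 1)"
  shows "0 \<le> slope_y a m (a - 1) L"
  using assms(3)
proof
  assume m: "m = 2*L \<and> L \<le> a - 2"
  define i u where "i = L - 1" and "u = a - 2 - L"
  have e: "a = i + u + 3" "L = i + 1" "m = 2*i + 2" and nonneg: "0 \<le> i" "0 \<le> u"
    using assms(2) m by (simp_all add: i_def u_def)
  show ?thesis
    unfolding slope_y_eq e using nonneg by (simp add: polynomial_expand)
next
  assume m: "m = 2*L + 1 \<and> L \<le> a + 1"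
  \<comment> \<open>For \<open>L \<le> 2\<close> the bound \<open>2 \<le> a\<close> is stronger than
    \<open>L \<le> a + 1\<close>, so \<open>a\<close> is measured from 2 there.\<close>
  have "L = 1 \<or> L = 2 \<or> 3 \<le> L" using assms(2) by linarith
  then consider "L \<le> 2" "L = 1 \<or> L = 2" | "3 \<le> L" by linarith
  then show ?thesis
  proof cases
    case 1
    define u where "u = a - 2"
    have e: "a = u + 2" and nonneg: "0 \<le> u" using assms(1) by (simp_all add: u_def)
    from 1(2) m show ?thesis
      unfolding slope_y_eq e using nonneg by (elim disjE) (simp_all add: polynomial_expand)
  next
    case 2
    define i u where "i = L - 3" and "u = a + 1 - L"
    have e: "a = i + u + 2" "L = i + 3" "m = 2*i + 7" and nonneg: "0 \<le> i" "0 \<le> u"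
      using 2 m by (simp_all add: i_def u_def)
    show ?thesis
      unfolding slope_y_eq e using nonneg by (simp add: polynomial_expand)
  qed
qed

text \<open>Bookkeeping shared by the next two lemmas: \<open>p\<close> and \<open>u\<close> are
  dropped, and the losses \<open>d\<close> and \<open>e\<close> (later \<open>k*(k + 1)\<close>) are
  replaced by bounds free of \<open>k\<close>. The factor 4 appears because it is \<open>2*k\<close>
  that gets bounded.\<close>

lemma nonneg_of_estimates:
  fixes s p q r u d e d' e' :: int
  assumes "s = p + q + r + u - d - 3*e - 1" "d \<le> d'" "4*e \<le> e'" "0 \<le> p" "0 \<le> u"
    "0 \<le> 4*(q + r - d' - 1) - 3*e'"
  shows "0 \<le> s"
  using assms by (smt (verit))

text \<open>A negative slope at \<open>L\<close> forces \<open>2*k \<le> a + L\<close>; then the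
  gain from \<open>y*(m - y)\<close> outweighs the losses that grow with \<open>k\<close>.\<close>

lemma slope_k_nonneg_even:
  assumes "1 \<le> k" "1 \<le> y" "y \<le> L" "L \<le> a - 2" "slope_y a (2*L) k L < 0"
  shows "0 \<le> slope_k a (2*L) k y"
proof -
  have k: "2*k \<le> a + L"
  proof (rule ccontr)
    assume "\<not> 2*k \<le> a + L"
    define u where "u = 2*k - a - L - 1"
    define v where "v = a - 2 - L"
    define i where "i = L - 1"
    have u: "2*k = u + a + L + 1" "0 \<le> u" using \<open>\<not> 2*k \<le> a + L\<close> by (simp_all add: u_def)
    \<comment> \<open>Doubling makes \<open>2*k\<close> the variable, so that the negated bound can
      be substituted as an equation with slack \<open>u\<close>.\<close>
    have "2 * slope_y a (2*L) k L =
       2*k * ((a + L) * (2*k) + 3 - a*(a + 2*L)) - 2*(a + L^2 + L - 1)"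
      unfolding slope_y_eq by algebra
    also have "\<dots> = (u + a + L + 1) * ((a + L) * (u + 1) + L^2 + 3) - 2*(a + L^2 + L - 1)"
      unfolding u(1) by algebra
    also have "\<dots> \<ge> 0"
    proof -
      have e: "L = i + 1" "a = i + v + 3" and nonneg: "0 \<le> i" "0 \<le> v"
        using assms by (simp_all add: i_def v_def)
      show ?thesis unfolding e using nonneg u(2) by (simp add: polynomial_expand)
    qed
    finally show False using assms(5) by simp
  qed
  show ?thesis
  \<comment> \<open>For \<open>L = 1\<close> the \<open>w\<close> below would be -2, and its
    nonnegativity is what lets the bound on \<open>k\<close> be applied.\<close>
  proof (cases "L = 1")
    case True
    then have y: "y = 1" using assms by simp
    define v where "v = a + 1 - 2*k"
    have e: "a = 2*k - 1 + v" "0 \<le> v" using k True by (simp_all add: v_def)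
    show ?thesis using assms(1,4) e(2) unfolding slope_k_eq y True e(1)
      by (simp add: polynomial_expand)
  next
    case False
    \<comment> \<open>\<open>- w\<close> is the value of \<open>(2*a + m)*y - a*m\<close> at
      \<open>y = 1\<close>.\<close>
    define w where "w = 2*a*L - 2*a - 2*L"
    define v where "v = a - 2 - L"
    define i where "i = L - 2"
    define t where "t = y - 1"
    have e: "L = i + 2" "a = i + v + 4" "y = t + 1" and nonneg: "0 \<le> i" "0 \<le> v" "0 \<le> t"
      using assms False by (simp_all add: i_def v_def t_def)
    have w: "0 \<le> w" unfolding w_def e using nonneg by (simp add: polynomial_expand)
    \<comment> \<open>The concave \<open>y*(m - y)\<close> is split into
      \<open>(y - 1)*(L - y)\<close> and its chord between \<open>y = 1\<close> and
      \<open>y = L\<close>.\<close>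
    have "slope_k a (2*L) k y =
        a*(a + 2*L)*((y - 1)*(L - y)) + a*(a + 2*L)*((L - 1)*y + L) + (a - 2*L + 3*y)
        + (2*k + 1)*(2*(a + L)*t) - (2*k + 1)*w - 3*(k*(k + 1)) - 1"
      unfolding slope_k_eq w_def t_def by algebra
    moreover have "(2*k + 1)*w \<le> (a + L + 1)*w"
      using k w by (intro mult_right_mono) auto
    moreover have "4*(k*(k + 1)) \<le> (a + L)*(a + L + 2)"
      using mult_mono[of "2*k" "a + L" "2*k+2" "a + L + 2"] k assms by (simp add: algebra_simps)
    moreover have "0 \<le> a*(a + 2*L)*((y - 1)*(L - y))"
      using assms by (intro mult_nonneg_nonneg) auto
    moreover have "0 \<le> (2*k + 1)*(2*(a + L)*t)"
      using assms nonneg by (intro mult_nonneg_nonneg) auto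
    moreover have "0 \<le> 4*(a*(a + 2*L)*((L - 1)*y + L) + (a - 2*L + 3*y) - (a + L + 1)*w - 1)
        - 3*((a + L)*(a + L + 2))"
      unfolding w_def e using nonneg by (simp add: polynomial_expand)
    ultimately show ?thesis by (rule nonneg_of_estimates)
  qed
qed

text \<open>The scheme for even \<open>m\<close> applies, but a negative slope at \<open>L\<close>,
  which is \<open>k * (2*(a + L)*k + k + 3) - L^2 - L\<close>, now gives the stronger
  \<open>2*k \<le> L\<close>. Since \<open>1 \<le> k\<close>, this also yields
  \<open>2 \<le> L\<close>.\<close>

lemma slope_k_nonneg_odd:
  assumes "2 \<le> a" "1 \<le> k" "1 \<le> y" "y \<le> L" "L \<le> a + 1" "slope_y a (2*L + 1) k L < 0"
  shows "0 \<le> slope_k a (2*L + 1) k y"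
proof -
  have "slope_y a (2*L + 1) k L = k * (2*(a + L)*k + k + 3) - L^2 - L"
    unfolding slope_y_eq by algebra
  then have *: "k * (2*(a + L)*k + k + 3) < L * (L + 1)"
    using assms(6) by (simp add: power2_eq_square algebra_simps)
  have k: "2*k \<le> L"
  proof (rule ccontr)
    assume "\<not> 2*k \<le> L"
    then have "L * (L + 1) \<le> (2*k) * (a + L)" using assms by (intro mult_mono) auto
    also have "\<dots> \<le> k * (2*(a + L)*k + k + 3)"
    proof -
      have "2*(a + L) * 1 \<le> 2*(a + L)*k" using assms by (intro mult_left_mono) auto
      then have "2*(a + L) \<le> 2*(a + L)*k + k + 3" using assms by linarith
      then have "k * (2*(a + L)) \<le> k * (2*(a + L)*k + k + 3)"
        using assms by (intro mult_left_mono) auto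
      then show ?thesis by (simp add: algebra_simps)
    qed
    finally show False using * by simp
  qed
  define w where "w = 2*a*L - a - 2*L - 1"
  define v where "v = a - 2"
  define i where "i = L - 2"
  define t where "t = y - 1"
  have e: "L = i + 2" "a = v + 2" "y = t + 1" and nonneg: "0 \<le> i" "0 \<le> v" "0 \<le> t"
    using assms k by (simp_all add: i_def v_def t_def)
  have w: "0 \<le> w" unfolding w_def e using nonneg by (simp add: polynomial_expand)
  have "slope_k a (2*L + 1) k y =
      a*(a + 2*L + 1)*((y - 1)*(L - y)) + a*(a + 2*L + 1)*(L*y + L) + (a - 2*L - 1 + 3*y)
      + (2*k + 1)*((2*a + 2*L + 1)*t) - (2*k + 1)*w - 3*(k*(k + 1)) - 1"
    unfolding slope_k_eq w_def t_def by algebra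
  moreover have "(2*k + 1)*w \<le> (L + 1)*w"
    using k w by (intro mult_right_mono) auto
  moreover have "4*(k*(k + 1)) \<le> L*(L + 2)"
    using mult_mono[of "2*k" "L" "2*k+2" "L + 2"] k assms by (simp add: algebra_simps)
  moreover have "0 \<le> a*(a + 2*L + 1)*((y - 1)*(L - y))"
    using assms by (intro mult_nonneg_nonneg) auto
  moreover have "0 \<le> (2*k + 1)*((2*a + 2*L + 1)*t)"
    using assms nonneg by (intro mult_nonneg_nonneg) auto
  moreover have "0 \<le> 4*(a*(a + 2*L + 1)*(L*y + L) + (a - 2*L - 1 + 3*y) - (L + 1)*w - 1)
      - 3*(L*(L + 2))"
    unfolding w_def e using nonneg by (simp add: polynomial_expand)
  ultimately show ?thesis by (rule nonneg_of_estimates)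
qed

text \<open>The norm is concave in \<open>y\<close>, so the sign of \<open>slope_y\<close> at \<open>L\<close> decides whether \<open>L + 1\<close> beats all
  smaller \<open>y\<close>; when it does not, \<open>k\<close> is small enough for the norm to increase with \<open>k\<close>.\<close>

lemma point_norm_le:
  assumes "2 \<le> a" "1 \<le> L" and m: "(m = 2*L \<and> L \<le> a - 2) \<or> (m = 2*L + 1 \<and> L \<le> a + 1)"
    and "0 \<le> k" "k \<le> a - 1" "1 \<le> y" "y \<le> m"
  shows "point_norm a m k y \<le> point_norm a m (a - 1) (L + 1)"
proof -
  have m': "2*L \<le> m" "m \<le> 2*L + 1" "m = 2*L \<or> m = 2*L + 1" using m by auto
  have middle: "point_norm a m k (L + 1) \<le> point_norm a m (a - 1) (L + 1)"
    if "0 \<le> k" "k \<le> a - 1" for k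
  proof (rule int_increasing_chain[of k "a - 1" "\<lambda>k. point_norm a m k (L + 1)"])
    fix t assume "k \<le> t" "t < a - 1"
    then have "0 \<le> slope_k a m t (L + 1)"
      using that assms(2) m'(3) by (intro slope_k_middle_nonneg) auto
    then show "point_norm a m t (L + 1) \<le> point_norm a m (t + 1) (L + 1)"
      by (simp add: slope_k_def)
  qed (rule that)
  have pos: "point_norm a m k y \<le> point_norm a m (a - 1) (L + 1)"
    if "1 \<le> k" "k \<le> a - 1" for k
    using that
  \<comment> \<open>Within row \<open>k\<close> the point is compared with \<open>y = L + 1\<close>;
    when that fails, the argument moves on to row \<open>k + 1\<close>.\<close>
  proof (induction "nat (a - k)" arbitrary: k rule: less_induct)
    case less
    have mid: "point_norm a m k (L + 1) \<le> point_norm a m (a - 1) (L + 1)"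
      using middle less.prems by simp
    consider "L + 1 \<le> y" | "y \<le> L" "slope_y a m k L < 0" | "y \<le> L" "0 \<le> slope_y a m k L"
      by linarith
    then show ?case
    proof cases
      case 1
      have "point_norm a m k y \<le> point_norm a m k (L + 1)"
      proof (rule int_decreasing_chain[OF 1])
        fix t assume "L + 1 \<le> t" "t < y"
        then have "slope_y a m k t \<le> 0"
          using less.prems assms(2,7) m'(1,2) by (intro slope_y_nonpos) linarith+
        then show "point_norm a m k (t + 1) \<le> point_norm a m k t" by (simp add: slope_y_def)
      qed
      with mid show ?thesis by linarith
    next
      case 2
      \<comment> \<open>In the last row the slope at \<open>L\<close> is nonnegative, so here
        \<open>k + 1\<close> is still at most \<open>a - 1\<close>.\<close>
      then have "k \<noteq> a - 1" using slope_y_last_nonneg[OF assms(1,2) m] by force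
      have "0 \<le> slope_k a m k y"
        using m
      proof
        assume "m = 2*L \<and> L \<le> a - 2"
        then show ?thesis using slope_k_nonneg_even[of k y L a] 2 less.prems assms(6) by simp
      next
        assume "m = 2*L + 1 \<and> L \<le> a + 1"
        then show ?thesis
          using slope_k_nonneg_odd[of a k y L] 2 less.prems assms(1,6) by simp
      qed
      moreover have "point_norm a m (k + 1) y \<le> point_norm a m (a - 1) (L + 1)"
        using less.prems \<open>k \<noteq> a - 1\<close> by (intro less.hyps) auto
      ultimately show ?thesis unfolding slope_k_def by linarith
    next
      case 3
      have "point_norm a m k y \<le> point_norm a m k (L + 1)"
      proof (rule int_increasing_chain[of y "L + 1"])
        fix t assume "y \<le> t" "t < L + 1"
        then have "slope_y a m k L \<le> slope_y a m k t"
          using less.prems assms(1,2) m'(1) by (intro slope_y_antimono) linarith+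
        then show "point_norm a m k t \<le> point_norm a m k (t + 1)"
          using 3 by (simp add: slope_y_def)
      qed (use 3 in linarith)
      with mid show ?thesis by linarith
    qed
  qed
  show ?thesis
  proof (cases "k = 0")
    case True
    have "point_norm a m 0 y \<le> point_norm a m 1 y"
      using slope_k_zero_nonneg[OF assms(1,6,7)] by (simp add: slope_k_def)
    also have "\<dots> \<le> point_norm a m (a - 1) (L + 1)" using pos[of 1] assms(1) by simp
    finally show ?thesis using True by simp
  next
    case False
    then show ?thesis using pos[of k] assms(4,5) by simp
  qed
qed

section \<open>Reduction modulo totally positive units\<close>

text \<open>The polynomial of the theorem is \<open>x*(x - a)*(x - b) - 1\<close>; in this form
  \<open>r\<close> and \<open>r - a\<close> are visibly units. The predicate lives in any field of
  characteristic 0, so it serves \<open>\<rho>\<close> and its real and complex conjugates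
  alike.\<close>

definition is_root :: "int \<Rightarrow> int \<Rightarrow> 'b::field_char_0 \<Rightarrow> bool" where
  "is_root a m r \<longleftrightarrow> r * (r - of_int a) * (r - of_int (a + m)) = 1"

type_synonym triple = "int \<times> int \<times> int"

text \<open>\<open>(x, y, z)\<close> stands for \<open>x + y g + z r\<close> with \<open>g = r (r - a)\<close>. With \<open>m = b - a\<close>, the unit
  \<open>r (r - a)\<^sup>2\<close> equals \<open>1 + m g\<close>, so in this basis the cones used below have simple inequalities.\<close>

fun elt :: "int \<Rightarrow> triple \<Rightarrow> 'b::field_char_0 \<Rightarrow> 'b" where
  "elt a (x, y, z) r = of_int x + of_int y * (r * (r - of_int a)) + of_int z * r"

fun add3 :: "triple \<Rightarrow> triple \<Rightarrow> triple" where
  "add3 (x, y, z) (x', y', z') = (x + x', y + y', z + z')"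

lemma elt_add3: "elt a (add3 u v) r = elt a u r + elt a v r"
  by (cases u; cases v) (simp add: algebra_simps)

text \<open>The separating values \<open>1/a\<close>, \<open>a - 1\<close> and \<open>a + m\<close>
  are the zeros of the weights used in \<open>height1_pos\<close> and \<open>height2_pos\<close>, so
  these bounds fix the signs of the weights.\<close>

locale cubic_roots =
  fixes a m :: int and r1 r2 r3 :: real
  assumes a_ge: "2 \<le> a" and m_ge: "2 \<le> m"
    and is_root: "\<And>r. r \<in> {r1, r2, r3} \<Longrightarrow> is_root a m r"
    and r1_pos: "0 < r1" and r1_less: "a * r1 < 1"
    and r2_gr: "a - 1 < r2" and r2_less: "r2 < a" and r3_gr: "a + m < r3"
begin

section \<open>Bounds and symmetric functions of the three roots\<close>

lemma root: "r \<in> {r1, r2, r3} \<Longrightarrow> r * (r - of_int a) * (r - of_int (a + m)) = 1"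
  using is_root unfolding is_root_def .

lemma am_gr: "1 < a * m"
  using mult_mono[of 2 a 2 m] a_ge m_ge by simp

lemma roots_order: "r1 < r2" "r2 < r3"
proof -
  have "2 * r1 \<le> a * r1" using a_ge r1_pos by (intro mult_right_mono) auto
  then show "r1 < r2" using r1_less r2_gr a_ge by linarith
  show "r2 < r3" using r2_less r3_gr m_ge by linarith
qed

lemma root_pos: "r \<in> {r1, r2, r3} \<Longrightarrow> 0 < r"
  using r1_pos roots_order by auto

lemma root_neq: "r \<in> {r1, r2, r3} \<Longrightarrow> r \<noteq> of_int a"
  using root[of r] by auto

lemma root_cubic:
  fixes r :: real
  assumes "r \<in> {r1, r2, r3}"
  shows "r^3 - (2 * a + m) * r^2 + a * (a + m) * r - 1 = 0"
  using root[OF assms] by (simp add: algebra_simps power2_eq_square power3_eq_cube)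

lemma vieta: "r1 + r2 + r3 = 2 * a + m" "r1 * r2 + r1 * r3 + r2 * r3 = a * (a + m)" "r1 * r2 * r3 = 1"
proof -
  define p q :: real where "p = 2 * a + m" and "q = a * (a + m)"
  have f: "r1^3 - p * r1^2 + q * r1 - 1 = 0" "r2^3 - p * r2^2 + q * r2 - 1 = 0"
    "r3^3 - p * r3^2 + q * r3 - 1 = 0"
    using root_cubic unfolding p_def q_def by auto
  have "(r1 - r2) * (r1^2 + r1*r2 + r2^2 - p*(r1 + r2) + q) = 0" using f by algebra
  then have 1: "r1^2 + r1*r2 + r2^2 - p*(r1 + r2) + q = 0" using roots_order by simp
  have "(r2 - r3) * (r2^2 + r2*r3 + r3^2 - p*(r2 + r3) + q) = 0" using f by algebra
  then have 2: "r2^2 + r2*r3 + r3^2 - p*(r2 + r3) + q = 0" using roots_order by simp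
  have "(r1 - r3) * (r1 + r2 + r3 - p) = 0" using 1 2 by algebra
  then have p: "r1 + r2 + r3 = p" using roots_order by simp
  then show "r1 + r2 + r3 = 2 * a + m" by (simp add: p_def)
  have q: "r1 * r2 + r1 * r3 + r2 * r3 = q" using 1 p by algebra
  then show "r1 * r2 + r1 * r3 + r2 * r3 = a * (a + m)" by (simp add: q_def)
  show "r1 * r2 * r3 = 1" using f(1) p q by algebra
qed

text \<open>This product is minus the value of the cubic at \<open>a\<close>, where
  \<open>x*(x - a)*(x - b)\<close> vanishes. Hence \<open>r - a\<close> has norm 1, although it is
  not totally positive.\<close>

lemma prod_shifted: "(r1 - a) * (r2 - a) * (r3 - a) = 1"
proof -
  define a' m' :: real where "a' = a" and "m' = m"
  have v: "r1 + r2 + r3 = 2 * a' + m'" "r1 * r2 + r1 * r3 + r2 * r3 = a' * (a' + m')"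
    "r1 * r2 * r3 = 1"
    using vieta by (simp_all add: a'_def m'_def)
  have "(r1 - a') * (r2 - a') * (r3 - a') =
      r1*r2*r3 - a'*(r1*r2 + r1*r3 + r2*r3) + a'^2*(r1 + r2 + r3) - a'^3" by algebra
  also have "\<dots> = 1" unfolding v by algebra
  finally show ?thesis unfolding a'_def .
qed

section \<open>Coordinates: positivity, norm and multiplication by units\<close>

definition pos :: "triple \<Rightarrow> bool" where
  "pos v \<longleftrightarrow> (\<forall>r\<in>{r1, r2, r3}. 0 < elt a v r)"

definition indec :: "triple \<Rightarrow> bool" where
  "indec v \<longleftrightarrow> pos v \<and> \<not> (\<exists>u w. pos u \<and> pos w \<and> v = add3 u w)"

definition nrm :: "triple \<Rightarrow> real" where
  "nrm v = elt a v r1 * elt a v r2 * elt a v r3"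

text \<open>With \<open>g = r*(r - a)\<close> one has \<open>g*r = 1 + (a + m)*g\<close>,
  \<open>r^2 = g + a*r\<close> and \<open>g*(r - a) = 1 + m*g\<close>. These relations give the four
  maps; the inverses are integral because \<open>r\<close> and \<open>r - a\<close> are
  units.\<close>

fun times_r :: "triple \<Rightarrow> triple" where
  "times_r (x, y, z) = (y, (a + m) * y + z, x + a * z)"

fun div_r :: "triple \<Rightarrow> triple" where
  "div_r (x, y, z) = (z - a * y + a * (a + m) * x, x, y - (a + m) * x)"

fun times_ra :: "triple \<Rightarrow> triple" where
  "times_ra (x, y, z) = (y - a * x, m * y + z, x)"

fun div_ra :: "triple \<Rightarrow> triple" where
  "div_ra (x, y, z) = (z, x + a * z, y - m * x - m * a * z)"

lemma inverses:
  "times_r (div_r v) = v" "div_r (times_r v) = v" "times_ra (div_ra v) = v" "div_ra (times_ra v) = v"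
  by (cases v; simp add: algebra_simps)+

lemma additive:
  "times_r (add3 u v) = add3 (times_r u) (times_r v)" "div_r (add3 u v) = add3 (div_r u) (div_r v)"
  "times_ra (add3 u v) = add3 (times_ra u) (times_ra v)"
  "div_ra (add3 u v) = add3 (div_ra u) (div_ra v)"
  by (cases u; cases v; simp add: algebra_simps)+

lemma elt_times_r: "r \<in> {r1, r2, r3} \<Longrightarrow> elt a (times_r v) r = r * elt a v r"
proof (cases v)
  case (fields x y z)
  assume "r \<in> {r1, r2, r3}"
  note root[OF this]
  then show ?thesis unfolding fields times_r.simps elt.simps of_int_add of_int_mult by algebra
qed

lemma elt_times_ra: "r \<in> {r1, r2, r3} \<Longrightarrow> elt a (times_ra v) r = (r - a) * elt a v r"
proof (cases v)
  case (fields x y z)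
  assume "r \<in> {r1, r2, r3}"
  note root[OF this]
  then show ?thesis
    unfolding fields times_ra.simps elt.simps of_int_add of_int_diff of_int_mult by algebra
qed

lemma elt_div_r: "r \<in> {r1, r2, r3} \<Longrightarrow> elt a (div_r v) r = elt a v r / r"
  using elt_times_r[of r "div_r v"] root_pos[of r] by (simp add: inverses field_simps)

lemma elt_div_ra: "r \<in> {r1, r2, r3} \<Longrightarrow> elt a (div_ra v) r = elt a v r / (r - a)"
  using elt_times_ra[of r "div_ra v"] root_neq[of r] by (simp add: inverses field_simps)

text \<open>All three roots are positive, but \<open>r - a\<close> takes both signs, so only its
  square preserves positivity.\<close>

lemma pos_units:
  assumes "pos v"
  shows "pos (times_r v)" "pos (div_r v)" "pos (times_ra (times_ra v))" "pos (div_ra (div_ra v))"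
proof -
  have *: "0 < (r - a) * ((r - a) * elt a v r)" if "r \<in> {r1, r2, r3}" for r
  proof -
    have "0 < (r - a)^2 * elt a v r"
      using assms that root_neq[OF that] unfolding pos_def by (intro mult_pos_pos) auto
    then show ?thesis by (simp add: power2_eq_square mult.assoc)
  qed
  have **: "0 < elt a v r / (r - a) / (r - a)" if "r \<in> {r1, r2, r3}" for r
  proof -
    have "0 < elt a v r / (r - a)^2"
      using assms that root_neq[OF that] unfolding pos_def by (intro divide_pos_pos) auto
    then show ?thesis by (simp add: power2_eq_square)
  qed
  show "pos (times_r v)" "pos (div_r v)" 
    using assms root_pos unfolding pos_def by (simp_all add: elt_times_r elt_div_r)
  show "pos (times_ra (times_ra v))"
    unfolding pos_def
  proof
    fix r assume r: "r \<in> {r1, r2, r3}"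
    show "0 < elt a (times_ra (times_ra v)) r" 
      using *[OF r] unfolding elt_times_ra[OF r] .
  qed
  show "pos (div_ra (div_ra v))"
    unfolding pos_def
  proof
    fix r assume r: "r \<in> {r1, r2, r3}"
    show "0 < elt a (div_ra (div_ra v)) r" 
      using **[OF r] unfolding elt_div_ra[OF r] .
  qed
qed

text \<open>A decomposition of \<open>f v\<close> pulls back along the additive map \<open>g\<close>
  to one of \<open>v\<close>.\<close>

lemma indec_transfer:
  assumes "indec v" "pos (f v)" "\<And>u. pos u \<Longrightarrow> pos (g u)" "\<And>u w. g (add3 u w) = add3 (g u) (g w)"
    "g (f v) = v"
  shows "indec (f v)"
  using assms unfolding indec_def by metis

lemma indec_units:
  assumes "indec v"
  shows "indec (times_r v)" "indec (div_r v)"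
    "indec (times_ra (times_ra v))" "indec (div_ra (div_ra v))"
proof -
  have "pos v" using assms by (simp add: indec_def)
  note p = pos_units[OF this]
  show "indec (times_r v)"
    by (rule indec_transfer[where g = div_r]) (auto simp: assms p pos_units inverses additive)
  show "indec (div_r v)"
    by (rule indec_transfer[where g = times_r]) (auto simp: assms p pos_units inverses additive)
  show "indec (times_ra (times_ra v))"
    by (rule indec_transfer[where g = "\<lambda>v. div_ra (div_ra v)" and f = "\<lambda>v. times_ra (times_ra v)"])
      (auto simp: assms p pos_units inverses additive)
  show "indec (div_ra (div_ra v))"
    by (rule indec_transfer[where g = "\<lambda>v. times_ra (times_ra v)" and f = "\<lambda>v. div_ra (div_ra v)"])
      (auto simp: assms p pos_units inverses additive)
qed

lemma nrm_times_r: "nrm (times_r v) = nrm v"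
proof -
  have "nrm (times_r v) = (r1 * r2 * r3) * nrm v"
    unfolding nrm_def by (simp add: elt_times_r del: times_r.simps)
  then show ?thesis by (simp add: vieta)
qed

lemma nrm_times_ra: "nrm (times_ra v) = nrm v"
proof -
  have "nrm (times_ra v) = ((r1 - a) * (r2 - a) * (r3 - a)) * nrm v"
    unfolding nrm_def by (simp add: elt_times_ra del: times_r.simps)
  then show ?thesis by (simp add: prod_shifted)
qed

lemma nrm_div: "nrm (div_r v) = nrm v" "nrm (div_ra v) = nrm v"
  using nrm_times_r[of "div_r v"] nrm_times_ra[of "div_ra v"] by (simp_all add: inverses)

section \<open>Positivity of the heights\<close>

text \<open>Each height is the trace form of a totally positive element, scaled so that it is constant on
  the vertices \<open>1, r, r (r - a)\<^sup>2\<close> of the first cone, respectively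
  \<open>1, (r - a)\<^sup>2, r (r - a)\<^sup>2\<close> of the second.\<close>

fun height1 :: "triple \<Rightarrow> int" where
  "height1 (x, y, z) = a * (x + z)"

fun height2 :: "triple \<Rightarrow> int" where
  "height2 (x, y, z) = a * x + (a^2 - 1) * z"

text \<open>With \<open>f\<close> the cubic, the identity says \<open>h = Tr(w*v / f')\<close>,
  multiplied by the Vandermonde product to clear denominators. The weight \<open>w\<close> takes the
  values \<open>w1\<close>, \<open>- w2\<close>, \<open>w3\<close> at the roots, matching the signs
  of \<open>f'\<close> there.\<close>

lemma sum_height:
  assumes "pos v" "0 < w1" "0 < w2" "0 < w3"
    and "(r3 - r2) * w1 * elt a v r1 + (r3 - r1) * w2 * elt a v r2 + (r2 - r1) * w3 * elt a v r3
      = (r2 - r1) * (r3 - r1) * (r3 - r2) * h"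
  shows "0 < h"
proof -
  have "0 < (r3 - r2) * w1 * elt a v r1" "0 < (r3 - r1) * w2 * elt a v r2"
    "0 < (r2 - r1) * w3 * elt a v r3" "0 < (r2 - r1) * (r3 - r1) * (r3 - r2)"
    using assms(1-4) roots_order by (simp_all add: pos_def)
  then have "0 < (r2 - r1) * (r3 - r1) * (r3 - r2) * h" using assms(5) by linarith
  with \<open>0 < (r2 - r1) * (r3 - r1) * (r3 - r2)\<close> show "0 < h" by (simp only: zero_less_mult_pos)
qed

lemma height1_pos:
  assumes "pos v"
  shows "0 < height1 v"
proof (cases v)
  case (fields x y z)
  define A M X Y Z :: real where "A = a" and "M = m" and "X = x" and "Y = y" and "Z = z"
  note reals = A_def M_def X_def Y_def Z_def
  \<comment> \<open>This quadratic changes sign between \<open>r1\<close> and \<open>r2\<close> and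
    between \<open>r2\<close> and \<open>r3\<close>, so \<open>w / f'\<close> is totally positive.
    By Euler's formula its trace form is the \<open>r^2\<close>-coefficient of \<open>w*v\<close>
    modulo the cubic, here \<open>x + z\<close>.\<close>
  define w where "w r = (r - (A + M)) * (r - A + 1)" for r
  have v: "r1 + r2 + r3 = 2 * A + M" "r1 * r2 + r1 * r3 + r2 * r3 = A * (A + M)" "r1 * r2 * r3 = 1"
    using vieta by (simp_all add: reals)
  have ord: "r1 - (A + M) < 0" "r1 - A + 1 < 0" "r2 - (A + M) < 0" "0 < r2 - A + 1"
    "0 < r3 - (A + M)" "0 < r3 - A + 1"
  proof -
    have "2 * r1 \<le> a * r1" using a_ge r1_pos by (intro mult_right_mono) auto
    then show "r1 - (A + M) < 0" "r1 - A + 1 < 0" "r2 - (A + M) < 0" "0 < r2 - A + 1"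
      "0 < r3 - (A + M)" "0 < r3 - A + 1"
      using r1_less r2_gr r2_less r3_gr a_ge m_ge unfolding reals by linarith+
  qed
  have "0 < X + Z"
  proof (rule sum_height[OF assms, of "w r1" "- w r2" "w r3"])
    show "0 < w r1" "0 < w r3" using ord by (simp_all add: w_def mult_neg_neg)
    show "0 < - w r2" using ord unfolding w_def by (simp add: mult_neg_pos)
    show "(r3 - r2) * w r1 * elt a v r1 + (r3 - r1) * (- w r2) * elt a v r2
        + (r2 - r1) * w r3 * elt a v r3 = (r2 - r1) * (r3 - r1) * (r3 - r2) * (X + Z)"
      unfolding w_def fields elt.simps reals[symmetric] using v by algebra
  qed
  then have "0 < x + z" unfolding reals by linarith
  then show ?thesis using a_ge by (simp add: fields)
qed

lemma height2_pos:
  assumes "pos v"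
  shows "0 < height2 v"
proof (cases v)
  case (fields x y z)
  define A M X Y Z :: real where "A = a" and "M = m" and "X = x" and "Y = y" and "Z = z"
  note reals = A_def M_def X_def Y_def Z_def
  \<comment> \<open>The same construction with the first zero moved from \<open>a - 1\<close> to
    \<open>1/a\<close>.\<close>
  define w where "w r = (r - (A + M)) * (A * r - 1)" for r
  have v: "r1 + r2 + r3 = 2 * A + M" "r1 * r2 + r1 * r3 + r2 * r3 = A * (A + M)" "r1 * r2 * r3 = 1"
    using vieta by (simp_all add: reals)
  have ord: "r1 - (A + M) < 0" "A * r1 - 1 < 0" "r2 - (A + M) < 0" "0 < A * r2 - 1"
    "0 < r3 - (A + M)" "0 < A * r3 - 1"
  proof -
    have "2 * r1 \<le> a * r1" "2 * r2 \<le> a * r2" "2 * r3 \<le> a * r3"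
      using a_ge r1_pos roots_order by (auto intro!: mult_right_mono)
    then show "r1 - (A + M) < 0" "A * r1 - 1 < 0" "r2 - (A + M) < 0" "0 < A * r2 - 1"
      "0 < r3 - (A + M)" "0 < A * r3 - 1"
      using r1_less r2_gr r2_less r3_gr a_ge m_ge unfolding reals by linarith+
  qed
  have "0 < A * X + (A^2 - 1) * Z"
  proof (rule sum_height[OF assms, of "w r1" "- w r2" "w r3"])
    show "0 < w r1" "0 < w r3" using ord by (simp_all add: w_def mult_neg_neg)
    show "0 < - w r2" using ord unfolding w_def by (simp add: mult_neg_pos)
    show "(r3 - r2) * w r1 * elt a v r1 + (r3 - r1) * (- w r2) * elt a v r2
        + (r2 - r1) * w r3 * elt a v r3
        = (r2 - r1) * (r3 - r1) * (r3 - r2) * (A * X + (A^2 - 1) * Z)"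
      unfolding w_def fields elt.simps reals[symmetric] using v by algebra
  qed
  then have "0 < real_of_int (a * x + (a^2 - 1) * z)" unfolding reals by simp
  then have "0 < a * x + (a^2 - 1) * z" by (simp only: of_int_0_less_iff)
  then show ?thesis by (simp add: fields)
qed

section \<open>The two cones and the indecomposables inside them\<close>

lemma combination_pos:
  fixes c1 c2 c3 u1 u2 u3 :: real
  assumes "0 \<le> c1" "0 \<le> c2" "0 \<le> c3" "c1 \<noteq> 0 \<or> c2 \<noteq> 0 \<or> c3 \<noteq> 0" "0 < u1" "0 < u2" "0 < u3"
  shows "0 < c1 * u1 + c2 * u2 + c3 * u3"
  using assms
  by (metis add_nonneg_nonneg add_nonneg_pos add_pos_nonneg less_eq_real_def mult_nonneg_nonneg
      mult_pos_pos)

text \<open>The inequalities say that the coordinates with respect to \<open>1\<close>,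
  \<open>r\<close>, \<open>r*(r - a)^2\<close> are nonnegative; multiplication by \<open>m\<close>
  makes these coordinates integers.\<close>

lemma cone1_pos:
  fixes x y z :: int
  assumes "0 \<le> m * x - y" "0 \<le> y" "0 \<le> z" "(x, y, z) \<noteq> (0, 0, 0)"
  shows "pos (x, y, z)"
  unfolding pos_def
proof
  fix r assume r: "r \<in> {r1, r2, r3}"
  have "real_of_int m * elt a (x, y, z) r = real_of_int (m * x - y) * 1 + real_of_int (m * z) * r
      + real_of_int y * (1 + m * (r * (r - a)))"
    by (simp add: algebra_simps)
  also have "1 + m * (r * (r - a)) = r * (r - a)^2"
    using root[OF r] unfolding of_int_add by algebra
  finally have "real_of_int m * elt a (x, y, z) r =
      real_of_int (m * x - y) * 1 + real_of_int (m * z) * r + real_of_int y * (r * (r - a)^2)" .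
  also have "\<dots> > 0"
    using assms m_ge root_pos[OF r] root_neq[OF r]
    by (intro combination_pos; (simp only: of_int_0_le_iff of_int_eq_0_iff)?) auto
  finally show "0 < elt a (x, y, z) r"
    using m_ge by (simp add: zero_less_mult_iff)
qed

text \<open>The vertices are now \<open>1\<close>, \<open>(r - a)^2\<close>,
  \<open>r*(r - a)^2\<close>, and the common denominator is \<open>a*m\<close>.\<close>

lemma cone2_pos:
  fixes x y z :: int
  assumes "0 \<le> a * m * (x + a * z) - (a * y + z)" "0 \<le> a * y + z" "z \<le> 0"
    "(x, y, z) \<noteq> (0, 0, 0)"
  shows "pos (x, y, z)"
  unfolding pos_def
proof
  fix r assume r: "r \<in> {r1, r2, r3}"
  have "1 + m * (r * (r - a)) = r * (r - a)^2" using root[OF r] unfolding of_int_add by algebra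
  then have "real_of_int (a * m) * elt a (x, y, z) r =
      real_of_int (a * m * (x + a * z) - (a * y + z)) * 1 + real_of_int (- m * z) * (r - a)^2
      + real_of_int (a * y + z) * (r * (r - a)^2)"
    unfolding elt.simps of_int_add of_int_diff of_int_mult of_int_minus by algebra
  also have "\<dots> > 0"
    using assms a_ge m_ge root_pos[OF r] root_neq[OF r]
    by (intro combination_pos; (simp only: of_int_0_le_iff of_int_eq_0_iff)?)
      (auto simp: mult_nonneg_nonpos)
  finally have "0 < real_of_int (a * m) * elt a (x, y, z) r" .
  moreover have "0 < real_of_int (a * m)" using am_gr by (simp only: of_int_0_less_iff)
  ultimately show "0 < elt a (x, y, z) r" by (rule zero_less_mult_pos)
qed

text \<open>The value 1 belongs to the vertices of the cones, the others to the lattice points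
  \<open>(1 + a*k, y, - k)\<close>.\<close>

definition reduced_norm :: "real \<Rightarrow> bool" where
  "reduced_norm n \<longleftrightarrow> n = 1 \<or>
     (\<exists>k y. 0 \<le> k \<and> k \<le> a - 1 \<and> 1 \<le> y \<and> y \<le> m \<and> n = of_int (point_norm a m k y))"

lemma nrm_point: "nrm (1 + a * k, y, - k) = of_int (point_norm a m k y)"
proof -
  define A M K Y :: real where "A = a" and "M = m" and "K = k" and "Y = y"
  note reals = A_def M_def K_def Y_def
  \<comment> \<open>In powers of \<open>u = r - a\<close> the constant terms with \<open>k\<close>
    cancel and the element is \<open>1 + c*u + y*u^2\<close>; its norm is then expanded in the
    symmetric functions of the shifted roots.\<close>
  define c where "c = A * Y - K"
  define u1 u2 u3 where "u1 = r1 - A" and "u2 = r2 - A" and "u3 = r3 - A"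
  define s1 s2 s3 where "s1 = u1 + u2 + u3" and "s2 = u1 * u2 + u1 * u3 + u2 * u3"
    and "s3 = u1 * u2 * u3"
  have v: "r1 + r2 + r3 = 2 * A + M" "r1 * r2 + r1 * r3 + r2 * r3 = A * (A + M)"
    using vieta by (simp_all add: reals)
  have "s1 = (r1 + r2 + r3) - 3 * A" unfolding s1_def u1_def u2_def u3_def by simp
  then have s1: "s1 = M - A" unfolding v by simp
  have "s2 = (r1 * r2 + r1 * r3 + r2 * r3) - 2 * A * (r1 + r2 + r3) + 3 * A^2"
    unfolding s2_def u1_def u2_def u3_def by algebra
  then have s2: "s2 = - A * M" unfolding v by algebra
  have s3: "s3 = 1" using prod_shifted unfolding s3_def u1_def u2_def u3_def reals .
  have "elt a (1 + a * k, y, - k) r = 1 + c * (r - A) + Y * (r - A)^2" for r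
    unfolding elt.simps of_int_add of_int_mult of_int_minus of_int_1 reals[symmetric] c_def
    by algebra
  then have "nrm (1 + a * k, y, - k) =
      (1 + c * u1 + Y * u1^2) * (1 + c * u2 + Y * u2^2) * (1 + c * u3 + Y * u3^2)"
    unfolding nrm_def u1_def u2_def u3_def by (simp only:)
  also have "\<dots> = 1 + c * s1 + Y * (s1^2 - 2 * s2) + c^2 * s2 + c * Y * (s1 * s2 - 3 * s3)
      + Y^2 * (s2^2 - 2 * s1 * s3) + c^3 * s3 + c^2 * Y * s3 * s1 + c * Y^2 * s3 * s2 + Y^3 * s3^2"
    unfolding s1_def s2_def s3_def by algebra
  also have "\<dots> = of_int (point_norm a m k y)"
    unfolding s1 s2 s3 c_def point_norm_def of_int_add of_int_mult of_int_diff of_int_power of_int_1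
      of_int_numeral reals[symmetric]
    by (simp add: polynomial_expand)
  finally show ?thesis .
qed

text \<open>The last two triples are \<open>r*(r - a)^2\<close> and \<open>(r - a)^2\<close>; all
  four vertices are units obtained from \<open>1\<close> by the unit maps.\<close>

lemma nrm_vertices:
  "nrm (1, 0, 0) = 1" "nrm (0, 0, 1) = 1" "nrm (1, m, 0) = 1" "nrm (a^2, 1, - a) = 1"
proof -
  show 1: "nrm (1, 0, 0) = 1" by (simp add: nrm_def)
  show 2: "nrm (0, 0, 1) = 1" using nrm_times_r[of "(1, 0, 0)"] 1 by simp
  show "nrm (1, m, 0) = 1"
    using nrm_times_ra[of "(0, 0, 1)"] nrm_times_ra[of "times_ra (0, 0, 1)"] 2 by simp
  show "nrm (a^2, 1, - a) = 1"
    using nrm_times_ra[of "(1, 0, 0)"] nrm_times_ra[of "times_ra (1, 0, 0)"] 1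
    by (simp add: power2_eq_square)
qed

lemma pos_vertices: "pos (1, 0, 0)" "pos (0, 0, 1)" "pos (1, m, 0)" "pos (a^2, 1, - a)"
  using m_ge a_ge cone1_pos[of 1 0 0] cone1_pos[of 0 0 1] cone1_pos[of 1 m 0]
    cone2_pos[where x = "a^2" and y = 1 and z = "- a"]
  by (simp_all add: power2_eq_square)

lemma not_pos_zero: "\<not> pos (0, 0, 0)"
  by (auto simp: pos_def)

lemma indec_minus_vertex:
  assumes "indec (x, y, z)" "pos (x', y', z')" "pos (x - x', y - y', z - z')"
  shows False
proof -
  have "(x, y, z) = add3 (x - x', y - y', z - z') (x', y', z')" by simp
  then show False using assms unfolding indec_def by blast
qed

text \<open>If a coordinate of a cone point is at least 1, subtracting the corresponding vertex
  leaves it in the cone. So an indecomposable that is not a vertex has all coordinates below 1, and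
  the nonzero lattice points left are \<open>(1, y, 0)\<close> with
  \<open>1 \<le> y < m\<close>.\<close>

lemma indec_cone1:
  assumes "indec (x, y, z)" "0 \<le> m * x - y" "0 \<le> y" "0 \<le> z"
  shows "reduced_norm (nrm (x, y, z))"
proof (rule ccontr)
  assume "\<not> ?thesis"
  then have ne: "(x, y, z) \<noteq> (1, 0, 0)" "(x, y, z) \<noteq> (0, 0, 1)" "(x, y, z) \<noteq> (1, m, 0)"
    using nrm_vertices unfolding reduced_norm_def by metis+
  have z: "z = 0"
    using indec_minus_vertex[OF assms(1) pos_vertices(2)] cone1_pos[of x y "z - 1"] assms(2-) ne(2)
    by force
  have "\<not> m \<le> y"
    using indec_minus_vertex[OF assms(1) pos_vertices(3)] cone1_pos[of "x - 1" "y - m" 0]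
      assms(2-) ne(3) z by (force simp: algebra_simps)
  moreover have "\<not> m \<le> m * x - y"
    using indec_minus_vertex[OF assms(1) pos_vertices(1)] cone1_pos[of "x - 1" y 0]
      assms(2-) ne(1) z by (force simp: algebra_simps)
  ultimately have y: "y < m" "m * x - y < m" by simp_all
  \<comment> \<open>The coordinates at \<open>1\<close> and \<open>r*(r - a)^2\<close> are both
    below 1 and add up to \<open>x\<close>.\<close>
  have "m * x < m * 2" using y by linarith
  then have "x < 2" using m_ge by simp
  have "0 \<le> m * x" using assms(2,3) by linarith
  then have "0 \<le> x" using m_ge by (simp add: zero_le_mult_iff)
  have "x \<noteq> 0"
  proof
    assume "x = 0"
    then have "y = 0" using assms(2,3) by simp
    then show False using assms(1) \<open>x = 0\<close> z not_pos_zero by (simp add: indec_def)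
  qed
  then have "x = 1" using \<open>0 \<le> x\<close> \<open>x < 2\<close> by linarith
  then have "nrm (x, y, z) = of_int (point_norm a m 0 y)" "1 \<le> y"
    using nrm_point[of 0 y] z y by simp_all
  then have "reduced_norm (nrm (x, y, z))"
    unfolding reduced_norm_def using y(1) a_ge by (intro disjI2 exI[of _ 0] exI[of _ y]) auto
  then show False using \<open>\<not> reduced_norm (nrm (x, y, z))\<close> by simp
qed

text \<open>The subtraction argument of the first cone applies again. The coordinate at
  \<open>(r - a)^2\<close> is \<open>- z / a\<close>, so \<open>k = - z\<close> runs from 0 to
  \<open>a - 1\<close>.\<close>

lemma indec_cone2:
  assumes "indec (x, y, z)" "0 \<le> a * m * (x + a * z) - (a * y + z)" "0 \<le> a * y + z" "z \<le> 0"
  shows "reduced_norm (nrm (x, y, z))"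
proof (rule ccontr)
  assume "\<not> ?thesis"
  then have ne: "(x, y, z) \<noteq> (1, 0, 0)" "(x, y, z) \<noteq> (a^2, 1, - a)" "(x, y, z) \<noteq> (1, m, 0)"
    using nrm_vertices unfolding reduced_norm_def by metis+
  have z: "- a < z"
  proof (rule ccontr)
    assume z: "\<not> - a < z"
    have "pos (x - a^2, y - 1, z - (- a))"
    proof (rule cone2_pos)
      have "a * m * (x - a^2 + a * (z - - a)) - (a * (y - 1) + (z - - a)) =
          a * m * (x + a * z) - (a * y + z)" by algebra
      then show "0 \<le> a * m * (x - a^2 + a * (z - - a)) - (a * (y - 1) + (z - - a))"
        using assms(2) by simp
      show "0 \<le> a * (y - 1) + (z - - a)" using assms(3) by (simp add: algebra_simps)
      show "z - - a \<le> 0" using z by simp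
      show "(x - a^2, y - 1, z - - a) \<noteq> (0, 0, 0)" using ne(2) by auto
    qed
    then show False using indec_minus_vertex[OF assms(1) pos_vertices(4)] by simp
  qed
  have "\<not> a * m \<le> a * y + z"
  proof
    assume *: "a * m \<le> a * y + z"
    have "pos (x - 1, y - m, z - 0)"
    proof (rule cone2_pos)
      have "a * m * (x - 1 + a * (z - 0)) - (a * (y - m) + (z - 0)) =
          a * m * (x + a * z) - (a * y + z)" by algebra
      then show "0 \<le> a * m * (x - 1 + a * (z - 0)) - (a * (y - m) + (z - 0))"
        using assms(2) by simp
      show "0 \<le> a * (y - m) + (z - 0)" using * by (simp add: algebra_simps)
      show "z - 0 \<le> 0" using assms(4) by simp
      show "(x - 1, y - m, z - 0) \<noteq> (0, 0, 0)" using ne(3) by auto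
    qed
    then show False using indec_minus_vertex[OF assms(1) pos_vertices(3)] by simp
  qed
  moreover have "\<not> a * m \<le> a * m * (x + a * z) - (a * y + z)"
  proof
    assume *: "a * m \<le> a * m * (x + a * z) - (a * y + z)"
    have "pos (x - 1, y - 0, z - 0)"
    proof (rule cone2_pos)
      have "a * m * (x - 1 + a * (z - 0)) - (a * (y - 0) + (z - 0)) =
          a * m * (x + a * z) - (a * y + z) - a * m" by algebra
      then show "0 \<le> a * m * (x - 1 + a * (z - 0)) - (a * (y - 0) + (z - 0))"
        using * by simp
      show "0 \<le> a * (y - 0) + (z - 0)" "z - 0 \<le> 0" using assms(3,4) by simp_all
      show "(x - 1, y - 0, z - 0) \<noteq> (0, 0, 0)" using ne(1) by auto
    qed
    then show False using indec_minus_vertex[OF assms(1) pos_vertices(1)] by simp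
  qed
  ultimately have y: "a * y + z < a * m" "a * m * (x + a * z) - (a * y + z) < a * m" by simp_all
  have am: "0 < a * m" using a_ge m_ge by simp
  \<comment> \<open>The sum of the coordinates at \<open>1\<close> and \<open>r*(r - a)^2\<close>:
    an integer in [0, 2) that vanishes only for the zero triple.\<close>
  define x' where "x' = x + a * z"
  have "a * m * x' < a * m * 2" using y unfolding x'_def by linarith
  then have "x' < 2" using am by (simp only: mult_less_cancel_left_pos)
  have "0 \<le> a * m * x'" using assms(2,3) unfolding x'_def by linarith
  then have "0 \<le> x'" using am by (simp add: zero_le_mult_iff)
  have "x' \<noteq> 0"
  proof
    assume "x' = 0"
    then have "a * y = - z" using assms(2,3) unfolding x'_def by simp
    then have "0 \<le> a * y" "a * y < a * 1" using assms(4) z by linarith+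
    then have "0 \<le> y" "y < 1" using a_ge by (simp_all add: zero_le_mult_iff)
    then have "y = 0" by simp
    then have "z = 0" "x = 0" using \<open>x' = 0\<close> \<open>a * y = - z\<close> by (simp_all add: x'_def)
    then show False using assms(1) \<open>y = 0\<close> not_pos_zero by (simp add: indec_def)
  qed
  then have x: "x = 1 + a * (- z)" using \<open>0 \<le> x'\<close> \<open>x' < 2\<close> unfolding x'_def by simp
  have "a * 0 \<le> a * y" using assms(3,4) by simp
  then have "0 \<le> y" using a_ge by (simp add: zero_le_mult_iff)
  moreover have "y \<noteq> 0" 
  proof
    assume "y = 0"
    then show False using assms(3,4) ne(1) x by simp
  qed
  moreover have "y \<le> m"
  proof -
    have "a * y < a * (m + 1)" using y(1) z by (simp add: algebra_simps)
    then show ?thesis using a_ge by simp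
  qed
  moreover have "nrm (x, y, z) = of_int (point_norm a m (- z) y)"
    using nrm_point[of "- z" y] x by simp
  ultimately have "reduced_norm (nrm (x, y, z))"
    unfolding reduced_norm_def using z assms(4) by (intro disjI2 exI[of _ "- z"] exI[of _ y]) auto
  then show False using \<open>\<not> reduced_norm (nrm (x, y, z))\<close> by simp
qed

section \<open>Descent between the two cones\<close>

text \<open>A point outside a cone is separated from it by one of the three faces. Across that face lies
  a unit translate of the other cone, whose height is smaller at this point because the surface of
  points of height one is strictly convex along the common edge.\<close>

lemma cross_cone1:
  assumes "indec (x, y, z)" "\<not> (0 \<le> m * x - y \<and> 0 \<le> y \<and> 0 \<le> z)"
  shows "\<exists>w. indec w \<and> nrm w = nrm (x, y, z) \<and> height2 w < height1 (x, y, z)"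
proof -
  \<comment> \<open>In this order the faces are shared with \<open>r\<close> times the second cone,
    with \<open>(r - a)^(-2)\<close> times it, and with the second cone itself. The two heights
    agree on the shared face, so new height minus old height is a positive multiple of the
    coordinate that vanishes there.\<close>
  consider "m * x - y < 0" | "y < 0" | "z < 0" using assms(2) by linarith
  then show ?thesis
  proof cases
    case 1
    have "height2 (div_r (x, y, z)) = height1 (x, y, z) + (m * x - y)"
      by (simp add: algebra_simps power2_eq_square)
    then show ?thesis using indec_units(2)[OF assms(1)] nrm_div(1)[of "(x, y, z)"] 1 by fastforce
  next
    case 2
    have "height2 (times_ra (times_ra (x, y, z))) = height1 (x, y, z) + (a * m - 1) * y"
      by (simp add: algebra_simps power2_eq_square)
    moreover have "(a * m - 1) * y < 0"
      using am_gr 2 by (intro mult_pos_neg) auto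
    moreover have "nrm (times_ra (times_ra (x, y, z))) = nrm (x, y, z)"
      by (simp only: nrm_times_ra)
    ultimately show ?thesis using indec_units(3)[OF assms(1)]
      by (intro exI[of _ "times_ra (times_ra (x, y, z))"] conjI; linarith?)
  next
    case 3
    have "height2 (x, y, z) = height1 (x, y, z) + (a * (a - 1) - 1) * z"
      by (simp add: algebra_simps power2_eq_square)
    moreover have "(a * (a - 1) - 1) * z < 0"
      using mult_mono[of 2 a 1 "a - 1"] a_ge 3 by (intro mult_pos_neg) auto
    ultimately show ?thesis using assms(1)
      by (intro exI[of _ "(x, y, z)"] conjI refl; linarith?)
  qed
qed

lemma cross_cone2:
  assumes "indec (x, y, z)"
    "\<not> (0 \<le> a * m * (x + a * z) - (a * y + z) \<and> 0 \<le> a * y + z \<and> z \<le> 0)"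
  shows "\<exists>w. indec w \<and> nrm w = nrm (x, y, z) \<and> height1 w < height2 (x, y, z)"
proof -
  \<comment> \<open>The neighbours are, in this order, \<open>(r - a)^2\<close> times the first
    cone, \<open>1 / r\<close> times it, and the first cone itself.\<close>
  consider "a * m * (x + a * z) - (a * y + z) < 0" | "a * y + z < 0" | "0 < z"
    using assms(2) by linarith
  then show ?thesis
  proof cases
    case 1
    have "height1 (div_ra (div_ra (x, y, z))) =
        height2 (x, y, z) + (a * m - 1) * (a * m * (x + a * z) - (a * y + z))"
      by (simp add: algebra_simps power2_eq_square)
    moreover have "(a * m - 1) * (a * m * (x + a * z) - (a * y + z)) < 0"
      using am_gr 1 by (intro mult_pos_neg) auto
    moreover have "nrm (div_ra (div_ra (x, y, z))) = nrm (x, y, z)"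
      by (simp only: nrm_div)
    ultimately show ?thesis using indec_units(4)[OF assms(1)]
      by (intro exI[of _ "div_ra (div_ra (x, y, z))"] conjI; linarith?)
  next
    case 2
    have "height1 (times_r (x, y, z)) = height2 (x, y, z) + (a * y + z)"
      by (simp add: algebra_simps power2_eq_square)
    then show ?thesis using indec_units(1)[OF assms(1)] nrm_times_r[of "(x, y, z)"] 2 by fastforce
  next
    case 3
    have "height1 (x, y, z) = height2 (x, y, z) + (1 + a * (1 - a)) * z"
      by (simp add: algebra_simps power2_eq_square)
    moreover have "(1 + a * (1 - a)) * z < 0"
      using mult_mono[of 2 a 1 "a - 1"] a_ge 3 by (intro mult_neg_pos) (auto simp: algebra_simps)
    ultimately show ?thesis using assms(1)
      by (intro exI[of _ "(x, y, z)"] conjI refl; linarith?)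
  qed
qed

text \<open>Descent on the heights, which are positive integers: a point outside its current cone
  has an associate with smaller height for the other cone. The disjunction in the induction claim
  lets the argument alternate between the two heights.\<close>

lemma indec_reduced_norm:
  assumes "indec v"
  shows "reduced_norm (nrm v)"
proof -
  have "indec v \<longrightarrow> nat (height1 v) = n \<or> nat (height2 v) = n \<longrightarrow> reduced_norm (nrm v)" for n
  proof (induction n arbitrary: v rule: less_induct)
    case (less n)
    obtain x y z where v: "v = (x, y, z)" by (cases v)
    show ?case
    proof (intro impI)
      assume v_indec: "indec v" and "nat (height1 v) = n \<or> nat (height2 v) = n"
      then consider "nat (height1 v) = n" | "nat (height2 v) = n" by blast
      then show "reduced_norm (nrm v)"
      proof cases
        case 1
        show ?thesis
        proof (cases "0 \<le> m * x - y \<and> 0 \<le> y \<and> 0 \<le> z")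
          case True
          then show ?thesis using indec_cone1 v_indec v by blast
        next
          case False
          then obtain w where w: "indec w" "nrm w = nrm v" "height2 w < height1 v"
            using cross_cone1 v_indec v by blast
          then have "nat (height2 w) < n" 
            using 1 height1_pos[of v] v_indec by (auto simp: indec_def)
          then have "reduced_norm (nrm w)" using less.IH[of _ w] w(1) by blast
          then show ?thesis using w(2) by simp
        qed
      next
        case 2
        show ?thesis
        proof (cases "0 \<le> a * m * (x + a * z) - (a * y + z) \<and> 0 \<le> a * y + z \<and> z \<le> 0")
          case True
          then show ?thesis using indec_cone2 v_indec v by blast
        next
          case False
          then obtain w where w: "indec w" "nrm w = nrm v" "height1 w < height2 v"
            using cross_cone2 v_indec v by blast
          then have "nat (height1 w) < n" 
            using 2 height2_pos[of v] v_indec by (auto simp: indec_def)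
          then have "reduced_norm (nrm w)" using less.IH[of _ w] w(1) by blast
          then show ?thesis using w(2) by simp
        qed
      qed
    qed
  qed
  from this[of "nat (height1 v)"] show ?thesis using assms by simp
qed

end

section \<open>The cubic field and its embeddings\<close>

text \<open>Coordinates are kept apart from the root, so one triple can be evaluated at
  \<open>\<rho>\<close> and at each of its conjugates.\<close>

fun qelt :: "rat \<times> rat \<times> rat \<Rightarrow> 'b::field_char_0 \<Rightarrow> 'b" where
  "qelt (x, y, z) r = of_rat x + of_rat y * r + of_rat z * r^2"

lemma is_root_cube:
  assumes "is_root a m r"
  shows "r^3 = of_rat (of_int (2 * a + m)) * r^2 - of_rat (of_int (a * (a + m))) * r + 1"
proof -
  have "r^3 = of_int (2 * a + m) * r^2 - of_int (a * (a + m)) * r + 1"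
    using assms unfolding is_root_def of_int_add of_int_mult of_int_numeral by algebra
  then show ?thesis by (simp only: of_rat_of_int_eq)
qed

text \<open>By the rational root argument a root would be an integer \<open>n\<close>. Then
  \<open>n\<close>, \<open>n - a\<close> and \<open>n - (a + m)\<close> would all be 1 or -1,
  although the first and the last differ by at least 4.\<close>

lemma no_rational_root:
  fixes q :: rat
  assumes "2 \<le> a" "2 \<le> m"
  shows "\<not> is_root a m q"
proof
  assume "is_root a m q"
  obtain n d where nd: "quotient_of q = (n, d)" by fastforce
  have d: "0 < d" "coprime n d" and q: "q = of_int n / of_int d"
    using nd quotient_of_denom_pos quotient_of_coprime quotient_of_div by blast+
  have "of_int (n * (n - a * d) * (n - (a + m) * d)) = (of_int (d^3) :: rat)"
    using \<open>is_root a m q\<close> d(1) unfolding is_root_def q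
    by (simp add: field_simps power3_eq_cube)
  then have eq: "n * (n - a * d) * (n - (a + m) * d) = d^3" by (simp only: of_int_eq_iff)
  have "n^3 = d * (d^2 + (2 * a + m) * n^2 - a * (a + m) * d * n)"
    using eq by algebra
  then have "d dvd n^3" by simp
  moreover have "coprime d (n^3)" using d(2) by (simp add: coprime_commute)
  ultimately have "is_unit d" by (metis coprime_common_divisor dvd_refl)
  then have "d = 1" using d(1) by simp
  with eq have *: "n * (n - a) * (n - (a + m)) = 1" by simp
  then have "is_unit n" "is_unit (n - a)" "is_unit (n - (a + m))"
    by (metis dvd_triv_left dvd_triv_right dvd_mult_left dvd_mult_right)+
  then show False using assms by auto
qed

lemma rational_linear_eq_zero:
  fixes r :: "'b::field_char_0"
  assumes "2 \<le> a" "2 \<le> m" "is_root a m r" "of_rat x + of_rat y * r = 0"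
  shows "x = 0 \<and> y = 0"
proof (cases "y = 0")
  case False
  then have "r = of_rat (- x / y)"
    using assms(4) by (simp add: of_rat_divide of_rat_minus field_simps eq_neg_iff_add_eq_0)
  then have "is_root a m (of_rat (- x / y) :: 'b)" using assms(3) by simp
  then have "of_rat ((- x / y) * (- x / y - of_int a) * (- x / y - of_int (a + m))) = (of_rat 1 :: 'b)"
    unfolding is_root_def by (simp only: of_rat_mult of_rat_diff of_rat_of_int_eq of_rat_1)
  then have "is_root a m (- x / y)" unfolding is_root_def by (simp only: of_rat_eq_iff)
  then show ?thesis using no_rational_root assms(1,2) by blast
qed (use assms(4) in simp)

text \<open>A quadratic relation would divide the cubic: the remainder is a linear relation, hence
  zero, and the quotient \<open>x - c\<close> makes \<open>c\<close> a rational root.\<close>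

lemma qelt_eq_zero:
  fixes r :: "'b::field_char_0"
  assumes a: "2 \<le> a" and m: "2 \<le> m" and root: "is_root a m r" and "qelt (x, y, z) r = 0"
  shows "(x, y, z) = (0, 0, 0)"
proof (cases "z = 0")
  case True
  then show ?thesis using rational_linear_eq_zero[OF a m root, of x y] assms(4) by simp
next
  case False
  define p q :: rat where "p = of_int (2 * a + m)" and "q = of_int (a * (a + m))"
  define u w where "u = y / z" and "w = x / z"
  define c where "c = p + u"
  have "of_rat z * (r^2 + of_rat u * r + of_rat w) = 0"
    using assms(4) False by (simp add: u_def w_def of_rat_divide algebra_simps)
  then have quad: "r^2 + of_rat u * r + of_rat w = 0" using False by simp
  have cube: "r^3 - of_rat p * r^2 + of_rat q * r - 1 = 0"
    using is_root_cube[OF root] by (simp add: p_def q_def)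
  have "of_rat (w * c - 1) + of_rat (u * c + q - w) * r =
      (r^3 - of_rat p * r^2 + of_rat q * r - 1) - (r^2 + of_rat u * r + of_rat w) * (r - of_rat c)"
    unfolding c_def of_rat_add of_rat_diff of_rat_mult of_rat_1 by algebra
  also have "\<dots> = 0" unfolding quad cube by simp
  finally have "of_rat (w * c - 1) + of_rat (u * c + q - w) * r = 0" .
  then have "w * c - 1 = 0 \<and> u * c + q - w = 0" using rational_linear_eq_zero[OF a m root] by blast
  then have "c^3 - p * c^2 + q * c - 1 = 0" unfolding c_def by algebra
  then have "is_root a m c"
    unfolding is_root_def p_def q_def of_int_add of_int_mult of_int_numeral by algebra
  then show ?thesis using no_rational_root[OF a m] by blast
qed

lemma qelt_diff: "qelt (x, y, z) r - qelt (x', y', z') r = qelt (x - x', y - y', z - z') r"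
  by (simp add: of_rat_diff algebra_simps)

lemma qelt_inject:
  assumes "2 \<le> a" "2 \<le> m" "is_root a m r" "qelt u r = qelt v r"
  shows "u = v"
proof -
  obtain x y z x' y' z' where uv: "u = (x, y, z)" "v = (x', y', z')" by (metis prod_cases3)
  have "qelt u r - qelt v r = 0" using assms(4) by simp
  then have "qelt (x - x', y - y', z - z') r = 0" unfolding uv qelt_diff .
  then show ?thesis using qelt_eq_zero[OF assms(1-3)] uv by fastforce
qed

fun qadd :: "rat \<times> rat \<times> rat \<Rightarrow> rat \<times> rat \<times> rat \<Rightarrow> rat \<times> rat \<times> rat" where
  "qadd (x, y, z) (x', y', z') = (x + x', y + y', z + z')"

text \<open>\<open>c3\<close> and \<open>c4\<close> are the coefficients of \<open>r^3\<close> and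
  \<open>r^4\<close>, which are reduced by \<open>r^3 = p*r^2 - q*r + 1\<close> and
  \<open>r^4 = (p^2 - q)*r^2 + (1 - p*q)*r + p\<close>.\<close>

fun qmult :: "int \<Rightarrow> int \<Rightarrow> rat \<times> rat \<times> rat \<Rightarrow> rat \<times> rat \<times> rat \<Rightarrow> rat \<times> rat \<times> rat" where
  "qmult a m (x, y, z) (x', y', z') =
    (let p = of_int (2 * a + m); q = of_int (a * (a + m)); c3 = y * z' + z * y'; c4 = z * z'
     in (x * x' + c3 + p * c4, x * y' + y * x' - q * c3 + (1 - p * q) * c4,
         x * z' + y * y' + z * x' + p * c3 + (p^2 - q) * c4))"

lemma qelt_add: "qelt (qadd u v) r = qelt u r + qelt v r"
  by (cases u; cases v) (simp add: of_rat_add algebra_simps)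

lemma qelt_mult:
  assumes "is_root a m r"
  shows "qelt (qmult a m u v) r = qelt u r * qelt v r"
proof -
  obtain x y z x' y' z' where uv: "u = (x, y, z)" "v = (x', y', z')" by (metis prod_cases3)
  define p q :: rat where "p = of_int (2 * a + m)" and "q = of_int (a * (a + m))"
  have cube: "r^3 = of_rat p * r^2 - of_rat q * r + 1"
    using is_root_cube[OF assms] unfolding p_def q_def .
  show ?thesis
    unfolding uv qmult.simps Let_def qelt.simps of_rat_add of_rat_diff of_rat_mult of_rat_1
      of_rat_power p_def[symmetric] q_def[symmetric]
    using cube by algebra
qed

section \<open>The span of 1, r, r^2 as the field Q(r)\<close>

definition qfield :: "'b::field_char_0 \<Rightarrow> 'b set" where
  "qfield r = range (\<lambda>v. qelt v r)"

lemma qfieldI: "x = qelt v r \<Longrightarrow> x \<in> qfield r"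
  by (auto simp: qfield_def)

lemma qfieldE:
  assumes "x \<in> qfield r"
  obtains v where "x = qelt v r"
  using assms unfolding qfield_def by blast

lemma qfield_closed:
  assumes "is_root a m r"
  shows "x \<in> qfield r \<Longrightarrow> y \<in> qfield r \<Longrightarrow> x + y \<in> qfield r"
    "x \<in> qfield r \<Longrightarrow> y \<in> qfield r \<Longrightarrow> x * y \<in> qfield r"
  by (metis qfieldE qfieldI qelt_add, metis qfieldE qfieldI qelt_mult[OF assms])

lemma of_rat_in_qfield: "of_rat q \<in> qfield r"
  by (rule qfieldI[of _ "(q, 0, 0)"]) simp

lemma self_in_qfield: "r \<in> qfield r"
  by (rule qfieldI[of _ "(0, 1, 0)"]) simp

lemma inverse_linear_in_qfield:
  assumes a: "2 \<le> a" and m: "2 \<le> m" and root: "is_root a m r"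
  shows "inverse (of_rat x + of_rat y * r) \<in> qfield r"
proof (cases "y = 0")
  case True
  then show ?thesis using of_rat_in_qfield[of "inverse x" r] by (simp add: of_rat_inverse)
next
  case False
  define p q :: rat where "p = of_int (2 * a + m)" and "q = of_int (a * (a + m))"
  define c where "c = - x / y"
  define f where "f = c^3 - p * c^2 + q * c - 1"
  have "f \<noteq> 0"
  proof
    assume "f = 0"
    then have "is_root a m c"
      unfolding f_def is_root_def p_def q_def of_int_add of_int_mult of_int_numeral by algebra
    then show False using no_rational_root[OF a m] by blast
  qed
  have cube: "r^3 - of_rat p * r^2 + of_rat q * r - 1 = 0"
    using is_root_cube[OF root] by (simp add: p_def q_def)
  have "x = - (c * y)" using False by (simp add: c_def)
  then have "of_rat x = - (of_rat c * of_rat y :: 'a)" by (simp add: of_rat_minus of_rat_mult)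
  \<comment> \<open>With \<open>F\<close> the cubic this is \<open>(F(r) - F(c)) / (r - c)\<close>,
    where \<open>F(r) = 0\<close> and \<open>F(c) = f\<close> is nonzero.\<close>
  define w where "w = r^2 + of_rat (c - p) * r + of_rat (c^2 - p * c + q)"
  have prod: "(of_rat x + of_rat y * r) * w = - of_rat (y * f)"
    using cube \<open>of_rat x = - (of_rat c * of_rat y)\<close>
    unfolding f_def w_def of_rat_add of_rat_diff of_rat_mult of_rat_power of_rat_1 of_rat_minus
    by algebra
  have "(of_rat x + of_rat y * r) * (of_rat (- inverse (y * f)) * w) =
      of_rat (- inverse (y * f)) * ((of_rat x + of_rat y * r) * w)" by (simp only: mult.left_commute)
  also have "\<dots> = 1"
    using False \<open>f \<noteq> 0\<close> unfolding prod by (simp add: field_simps flip: of_rat_mult of_rat_minus)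
  finally have "inverse (of_rat x + of_rat y * r) = of_rat (- inverse (y * f)) * w"
    by (rule inverse_unique)
  moreover have "w \<in> qfield r"
    unfolding w_def by (rule qfieldI[of _ "(c^2 - p * c + q, c - p, 1)"]) simp
  ultimately show ?thesis using qfield_closed(2)[OF root] of_rat_in_qfield by metis
qed

lemma inverse_in_qfield:
  assumes a: "2 \<le> a" and m: "2 \<le> m" and root: "is_root a m r" and "w \<in> qfield r"
  shows "inverse w \<in> qfield r"
proof -
  obtain x y z where w: "w = qelt (x, y, z) r" using assms(4) by (auto simp: qfield_def)
  show ?thesis
  proof (cases "z = 0 \<or> w = 0")
    case True
    then show ?thesis
      using inverse_linear_in_qfield[OF a m root, of x y] of_rat_in_qfield[of 0 r] w by auto
  next
    case False
    define p q :: rat where "p = of_int (2 * a + m)" and "q = of_int (a * (a + m))"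
    have cube: "r^3 - of_rat p * r^2 + of_rat q * r - 1 = 0"
      using is_root_cube[OF root] by (simp add: p_def q_def)
    \<comment> \<open>A linear factor chosen so that the \<open>r^2\<close>-coefficient of
      \<open>w * l\<close> cancels once \<open>r^3\<close> is reduced, which leaves the linear
      case.\<close>
    define l where "l = of_rat (- (p * z + y)) + of_rat z * r"
    define s t where "s = - x * (p * z + y) + z^2" and "t = z * x - q * z^2 - y * (p * z + y)"
    have "w * l = of_rat s + of_rat t * r"
      using cube unfolding w l_def s_def t_def qelt.simps of_rat_add of_rat_diff of_rat_mult
        of_rat_power of_rat_1 of_rat_minus
      by algebra
    moreover have "l \<noteq> 0"
      using rational_linear_eq_zero[OF a m root] False unfolding l_def by blast
    moreover have "inverse w = l * inverse (w * l)" using \<open>l \<noteq> 0\<close> False by simp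
    ultimately have "inverse w = l * inverse (of_rat s + of_rat t * r)" by simp
    moreover have "l \<in> qfield r"
      unfolding l_def by (rule qfieldI[of _ "(- (p * z + y), z, 0)"]) simp
    ultimately show ?thesis
      using inverse_linear_in_qfield[OF a m root] qfield_closed(2)[OF root] by metis
  qed
qed

lemma subfield_of_rat:
  fixes F :: "'a::field_char_0 set"
  assumes "is_subfield F"
  shows "of_rat q \<in> F"
proof -
  have nat: "of_nat n \<in> F" for n
    using assms by (induction n) (auto simp: is_subfield_def)
  have int: "of_int i \<in> F" for i
    using nat assms by (cases i rule: int_cases2) (auto simp: is_subfield_def)
  obtain i j where "q = of_int i / of_int j" by (metis quotient_of_div surj_pair)
  then have "of_rat q = (of_int i / of_int j :: 'a)" by (simp add: of_rat_divide)
  moreover have "of_int i * inverse (of_int j) \<in> F" for i j using int assms by (simp add: is_subfield_def)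
  ultimately show ?thesis by (simp add: divide_inverse)
qed

lemma rat_adjoin_eq:
  assumes a: "2 \<le> a" and m: "2 \<le> m" and root: "is_root a m r"
  shows "rat_adjoin r = qfield r"
proof
  have "- x = of_rat (- 1) * x" for x :: 'a by simp
  then have "- x \<in> qfield r" if "x \<in> qfield r" for x
    using that of_rat_in_qfield qfield_closed(2)[OF root] by metis
  then have "is_subfield (qfield r)"
    using qfield_closed[OF root] inverse_in_qfield[OF a m root] of_rat_in_qfield[of 0 r]
      of_rat_in_qfield[of 1 r]
    unfolding is_subfield_def by auto
  then show "rat_adjoin r \<subseteq> qfield r"
    using self_in_qfield unfolding rat_adjoin_def by blast
  show "qfield r \<subseteq> rat_adjoin r"
    unfolding rat_adjoin_def
  proof (rule Inter_greatest)
    fix F assume "F \<in> {F. is_subfield F \<and> r \<in> F}"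
    then have F: "is_subfield F" "r \<in> F" by auto
    have "qelt (x, y, z) r \<in> F" for x y z
      using F subfield_of_rat[OF F(1)] by (simp add: is_subfield_def power2_eq_square)
    then show "qfield r \<subseteq> F" unfolding qfield_def by auto
  qed
qed

section \<open>Embeddings correspond to roots of the cubic\<close>

text \<open>Coordinates with respect to \<open>1, \<rho>, \<rho>\<^sup>2\<close> are unique, so \<open>SOME\<close> makes no choice here.\<close>

definition root_embedding :: "'a::field_char_0 \<Rightarrow> 'b::field_char_0 \<Rightarrow> 'a \<Rightarrow> 'b" where
  "root_embedding \<rho> r = restrict (\<lambda>x. qelt (SOME v. x = qelt v \<rho>) r) (qfield \<rho>)"

lemma root_embedding_qelt:
  assumes "2 \<le> a" "2 \<le> m" "is_root a m \<rho>"
  shows "root_embedding \<rho> r (qelt v \<rho>) = qelt v r"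
proof -
  have "(SOME u. qelt v \<rho> = qelt u \<rho>) = v"
    using qelt_inject[OF assms] by (intro some_equality) auto
  then show ?thesis unfolding root_embedding_def qfield_def by simp
qed

text \<open>Homomorphisms fix the rationals, so \<open>s\<close> is determined by
  \<open>s \<rho>\<close>.\<close>

lemma embedding_qelt:
  fixes s :: "'a::field_char_0 \<Rightarrow> 'b::field_char_0"
  assumes root: "is_root a m \<rho>" and s: "s \<in> field_embeddings (qfield \<rho>)"
  shows "s (qelt v \<rho>) = qelt v (s \<rho>)"
proof -
  note closed = qfield_closed[OF root] of_rat_in_qfield self_in_qfield
  have add: "s (x + y) = s x + s y" and mult: "s (x * y) = s x * s y"
    if "x \<in> qfield \<rho>" "y \<in> qfield \<rho>" for x y
    using s that unfolding field_embeddings_def by auto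
  have one: "s 1 = 1" using s unfolding field_embeddings_def by auto
  have rat: "of_int i \<in> qfield \<rho>" for i using of_rat_in_qfield[of "of_int i" \<rho>] by simp
  have zero: "s 0 = 0" using add[of 0 0] rat[of 0] by simp
  have nat: "s (of_nat n) = of_nat n" for n
  proof (induction n)
    case (Suc n)
    then show ?case using add[of 1 "of_nat n"] rat[of 1] rat[of "int n"] one by simp
  qed (simp add: zero)
  have int: "s (of_int i) = of_int i" for i
  proof (cases i rule: int_cases2)
    case (nonpos n)
    have "s (- of_nat n) + s (of_nat n) = 0"
      using add[of "- of_nat n" "of_nat n"] rat[of "- int n"] rat[of "int n"] zero by simp
    then have "s (- of_nat n) = - of_nat n" by (simp add: nat eq_neg_iff_add_eq_0)
    then show ?thesis by (simp add: nonpos)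
  qed (simp add: nat)
  have rat_fixed: "s (of_rat q) = of_rat q" for q
  proof -
    obtain i j where ij: "quotient_of q = (i, j)" by fastforce
    then have j: "0 < j" and q: "q = of_int i / of_int j"
      using quotient_of_denom_pos quotient_of_div by blast+
    have "of_rat q * of_int j = (of_int i :: 'a)" using j by (simp add: q of_rat_divide)
    then have "s (of_rat q) * of_int j = of_int i"
      using mult[of "of_rat q" "of_int j"] of_rat_in_qfield[of q \<rho>] rat[of j] int by simp
    then show ?thesis using j by (simp add: q of_rat_divide field_simps)
  qed
  obtain x y z where v: "v = (x, y, z)" by (metis prod_cases3)
  have "s (of_rat y * \<rho>) = of_rat y * s \<rho>" "s (of_rat z * (\<rho> * \<rho>)) = of_rat z * (s \<rho> * s \<rho>)"
    by (simp_all add: mult closed rat_fixed)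
  then show ?thesis
    unfolding v qelt.simps power2_eq_square by (simp add: add closed rat_fixed)
qed

lemma embedding_root:
  assumes root: "is_root a m \<rho>" and s: "s \<in> field_embeddings (qfield \<rho>)"
  shows "is_root a m (s \<rho>)"
proof -
  define u v w :: "rat \<times> rat \<times> rat" where "u = (0, 1, 0)" and "v = (- of_int a, 1, 0)"
    and "w = (- of_int (a + m), 1, 0)"
  have uvw: "qelt u r = r" "qelt v r = r - of_int a" "qelt w r = r - of_int (a + m)" 
    for r :: "'c::field_char_0"
    by (simp_all add: u_def v_def w_def of_rat_minus of_rat_add of_rat_diff)
  have mult: "s (x * y) = s x * s y" if "x \<in> qfield \<rho>" "y \<in> qfield \<rho>" for x y
    using s that unfolding field_embeddings_def by auto
  have "qelt v \<rho> \<in> qfield \<rho>" for v by (rule qfieldI[OF refl])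
  note closed = this qfield_closed(2)[OF root]
  have "qelt u \<rho> * qelt v \<rho> * qelt w \<rho> = 1" using root unfolding is_root_def uvw .
  then have "s (qelt u \<rho> * qelt v \<rho> * qelt w \<rho>) = 1"
    using s unfolding field_embeddings_def by simp
  also have "s (qelt u \<rho> * qelt v \<rho> * qelt w \<rho>) = s (qelt u \<rho>) * s (qelt v \<rho>) * s (qelt w \<rho>)"
    by (simp only: mult closed)
  also have "\<dots> = s \<rho> * (s \<rho> - of_int a) * (s \<rho> - of_int (a + m))"
    unfolding embedding_qelt[OF assms] unfolding uvw ..
  finally show ?thesis unfolding is_root_def .
qed

lemma root_embedding_in:
  assumes "2 \<le> a" "2 \<le> m" "is_root a m \<rho>" "is_root a m r"
  shows "root_embedding \<rho> r \<in> field_embeddings (qfield \<rho>)"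
proof -
  note emb = root_embedding_qelt[OF assms(1-3), of r]
  have "root_embedding \<rho> r \<in> extensional (qfield \<rho>)"
    unfolding root_embedding_def by simp
  moreover have "root_embedding \<rho> r 1 = 1" using emb[of "(1, 0, 0)"] by simp
  moreover have "root_embedding \<rho> r (x + y) = root_embedding \<rho> r x + root_embedding \<rho> r y \<and>
      root_embedding \<rho> r (x * y) = root_embedding \<rho> r x * root_embedding \<rho> r y"
    if xy: "x \<in> qfield \<rho>" "y \<in> qfield \<rho>" for x y
  proof -
    obtain u v where uv: "x = qelt u \<rho>" "y = qelt v \<rho>"
      using xy unfolding qfield_def by blast
    show ?thesis
      unfolding uv qelt_add[symmetric] qelt_mult[OF assms(3), symmetric] emb
      by (simp add: qelt_add qelt_mult[OF assms(4)])
  qed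
  ultimately show ?thesis unfolding field_embeddings_def by auto
qed

lemma field_embeddings_eq:
  assumes "2 \<le> a" "2 \<le> m" "is_root a m \<rho>"
  shows "field_embeddings (qfield \<rho>) = root_embedding \<rho> ` {r :: 'b::field_char_0. is_root a m r}"
proof (intro equalityI subsetI)
  fix s :: "'a \<Rightarrow> 'b" assume s: "s \<in> field_embeddings (qfield \<rho>)"
  have "s = root_embedding \<rho> (s \<rho>)"
  proof (rule extensionalityI)
    show "s \<in> extensional (qfield \<rho>)" using s unfolding field_embeddings_def by auto
    show "root_embedding \<rho> (s \<rho>) \<in> extensional (qfield \<rho>)" unfolding root_embedding_def by simp
    fix x assume "x \<in> qfield \<rho>"
    then obtain v where "x = qelt v \<rho>" by (auto simp: qfield_def)
    then show "s x = root_embedding \<rho> (s \<rho>) x"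
      using root_embedding_qelt[OF assms] embedding_qelt[OF assms(3) s] by metis
  qed
  then show "s \<in> root_embedding \<rho> ` {r. is_root a m r}"
    using embedding_root[OF assms(3) s] by blast
qed (use root_embedding_in[OF assms] in auto)

lemma inj_root_embedding:
  assumes "2 \<le> a" "2 \<le> m" "is_root a m \<rho>"
  shows "inj (root_embedding \<rho> :: 'b::field_char_0 \<Rightarrow> _)"
proof (rule injI)
  fix r r' :: 'b assume "root_embedding \<rho> r = root_embedding \<rho> r'"
  then show "r = r'" using root_embedding_qelt[OF assms, where v = "(0, 1, 0)"]
    by (metis add_0 add_0_right mult_1 mult_zero_left of_rat_0 of_rat_1 qelt.simps)
qed

lemma elt_eq_qelt:
  "elt a (x, y, z) r = qelt (of_int x, of_int (z - a * y), of_int y) r"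
  by (simp add: algebra_simps power2_eq_square of_rat_diff of_rat_mult)

lemma elt_in_qfield: "elt a v r \<in> qfield r"
  by (cases v) (simp only: elt_eq_qelt, rule qfieldI[OF refl])

lemma root_embedding_elt:
  assumes "2 \<le> a" "2 \<le> m" "is_root a m \<rho>"
  shows "root_embedding \<rho> r (elt a v \<rho>) = elt a v r"
  by (cases v) (simp only: elt_eq_qelt root_embedding_qelt[OF assms])

text \<open>The basis of \<open>elt\<close> arises from \<open>1\<close>, \<open>\<rho>\<close>,
  \<open>\<rho>^2\<close> by a unimodular change, and its integral span is closed under the Horner
  step \<open>c + \<rho> * w\<close>.\<close>

lemma int_adjoin_eq:
  fixes \<rho> :: "'a::field_char_0"
  assumes "is_root a m \<rho>"
  shows "int_adjoin \<rho> = range (\<lambda>v. elt a v \<rho>)"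
proof (intro equalityI subsetI)
  fix x assume "x \<in> int_adjoin \<rho>"
  then obtain p :: "int poly" where x: "x = poly (map_poly of_int p) \<rho>"
    by (auto simp: int_adjoin_def)
  have "\<exists>v. poly (map_poly of_int p) \<rho> = elt a v \<rho>" for p :: "int poly"
  proof (induction p)
    case 0
    show ?case by (rule exI[of _ "(0, 0, 0)"]) simp
  next
    case (pCons c p)
    then obtain x y z where v: "poly (map_poly of_int p) \<rho> = elt a (x, y, z) \<rho>" by auto
    have "poly (map_poly of_int (pCons c p)) \<rho> = of_int c + \<rho> * elt a (x, y, z) \<rho>"
      by (simp add: map_poly_pCons v)
    also have "\<dots> = elt a (c + y, (a + m) * y + z, x + a * z) \<rho>"
      using assms unfolding is_root_def elt.simps of_int_add of_int_mult by algebra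
    finally show ?case by blast
  qed
  then show "x \<in> range (\<lambda>v. elt a v \<rho>)" unfolding x by blast
next
  fix w assume "w \<in> range (\<lambda>v. elt a v \<rho>)"
  then obtain x y z where w: "w = elt a (x, y, z) \<rho>" by auto
  have "w = poly (map_poly of_int [:x, z - a * y, y:]) \<rho>"
    unfolding w by (simp add: map_poly_pCons algebra_simps)
  then show "w \<in> int_adjoin \<rho>" unfolding int_adjoin_def by blast
qed

lemma elt_of_real: "elt a v (of_real r) = (of_real (elt a v r) :: 'b::real_field)"
  by (cases v) simp

section \<open>Translation of the field notions into coordinates\<close>

context cubic_roots
begin

text \<open>By Vieta the cubic splits over the reals, so every complex root is one of
  \<open>r1\<close>, \<open>r2\<close>, \<open>r3\<close>: the field is totally real.\<close>

lemma is_root_iff: "is_root a m (r :: 'b::real_field) \<longleftrightarrow> r \<in> of_real ` {r1, r2, r3}"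
proof -
  define A M R1 R2 R3 :: 'b where "A = of_int a" and "M = of_int m"
    and "R1 = of_real r1" and "R2 = of_real r2" and "R3 = of_real r3"
  have of_real: "(of_real (of_int i) :: 'b) = of_int i" for i by simp
  have "of_real (r1 + r2 + r3) = (of_real (of_int (2 * a + m)) :: 'b)"
    "of_real (r1 * r2 + r1 * r3 + r2 * r3) = (of_real (of_int (a * (a + m))) :: 'b)"
    "of_real (r1 * r2 * r3) = (of_real 1 :: 'b)"
    using vieta by simp_all
  then have v: "R1 + R2 + R3 = 2 * A + M" "R1 * R2 + R1 * R3 + R2 * R3 = A * (A + M)" "R1 * R2 * R3 = 1"
    by (simp_all add: A_def M_def R1_def R2_def R3_def)
  have "r * (r - A) * (r - (A + M)) - 1 = (r - R1) * (r - R2) * (r - R3)"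
    using v by algebra
  moreover have "is_root a m r \<longleftrightarrow> r * (r - A) * (r - (A + M)) - 1 = 0"
    unfolding is_root_def A_def M_def by simp
  ultimately show ?thesis by (auto simp: R1_def R2_def R3_def)
qed

lemma totally_positive_iff:
  fixes \<rho> :: "'a::field_char_0"
  assumes "is_root a m \<rho>"
  shows "totally_positive (rat_adjoin \<rho>) (elt a v \<rho>) \<longleftrightarrow> pos v"
proof -
  have "{r :: real. is_root a m r} = {r1, r2, r3}" by (auto simp: is_root_iff)
  then show ?thesis
    unfolding totally_positive_def rat_adjoin_eq[OF a_ge m_ge assms]
      field_embeddings_eq[OF a_ge m_ge assms] pos_def
    by (simp add: elt_in_qfield root_embedding_elt[OF a_ge m_ge assms])
qed

text \<open>The complex embeddings are indexed by the three real roots, so the product is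
  \<open>nrm v\<close>; its integer value \<open>n\<close> identifies the rational selected by
  \<open>THE\<close>.\<close>

lemma field_norm_elt:
  fixes \<rho> :: "'a::field_char_0"
  assumes "is_root a m \<rho>" "nrm v = of_int n"
  shows "field_norm (rat_adjoin \<rho>) (elt a v \<rho>) = of_int n"
proof -
  have "(\<Prod>s \<in> (field_embeddings (rat_adjoin \<rho>) :: ('a \<Rightarrow> complex) set). s (elt a v \<rho>)) =
      (\<Prod>r \<in> {r :: complex. is_root a m r}. root_embedding \<rho> r (elt a v \<rho>))"
    unfolding rat_adjoin_eq[OF a_ge m_ge assms(1)] field_embeddings_eq[OF a_ge m_ge assms(1)]
    using inj_root_embedding[OF a_ge m_ge assms(1)]
    by (subst prod.reindex) (auto intro: inj_on_subset)
  also have "{r :: complex. is_root a m r} = of_real ` {r1, r2, r3}"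
    by (auto simp: is_root_iff)
  also have "(\<Prod>r \<in> of_real ` {r1, r2, r3}. root_embedding \<rho> r (elt a v \<rho>)) = complex_of_real (nrm v)"
    unfolding root_embedding_elt[OF a_ge m_ge assms(1)] using roots_order
    by (simp add: elt_of_real nrm_def mult.assoc)
  also have "\<dots> = of_int n" using assms(2) by simp
  finally have "field_norm (rat_adjoin \<rho>) (elt a v \<rho>) = (THE q. of_rat q = (of_int n :: complex))"
    unfolding field_norm_def by simp
  also have "\<dots> = of_int n"
  proof (rule the_equality)
    fix q assume "of_rat q = (of_int n :: complex)"
    then have "of_rat q = (of_rat (of_int n) :: complex)" by simp
    then show "q = of_int n" by (simp only: of_rat_eq_iff)
  qed simp
  finally show ?thesis .
qed

lemma indec_of_indecomposable:
  fixes \<rho> :: "'a::field_char_0"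
  assumes "is_root a m \<rho>" "indecomposable_in (rat_adjoin \<rho>) (int_adjoin \<rho>) \<alpha>"
  obtains v where "\<alpha> = elt a v \<rho>" "indec v"
proof -
  note tp = totally_positive_iff[OF assms(1)]
  obtain v where v: "\<alpha> = elt a v \<rho>"
    using assms(2) unfolding indecomposable_in_def int_adjoin_eq[OF assms(1)] by blast
  have "pos v" using assms(2) unfolding indecomposable_in_def v tp by blast
  moreover have False if "pos u" "pos w" "v = add3 u w" for u w
    using assms(2) that unfolding indecomposable_in_def int_adjoin_eq[OF assms(1)] v
    using tp elt_add3 by blast
  ultimately show ?thesis using that v unfolding indec_def by blast
qed

lemma norm_indecomposable_le:
  fixes \<rho> :: "'a::field_char_0"
  assumes "is_root a m \<rho>" "indecomposable_in (rat_adjoin \<rho>) (int_adjoin \<rho>) \<alpha>"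
    and "1 \<le> L" "(m = 2*L \<and> L \<le> a - 2) \<or> (m = 2*L + 1 \<and> L \<le> a + 1)"
  shows "field_norm (rat_adjoin \<rho>) \<alpha> \<le> of_int (point_norm a m (a - 1) (L + 1))"
proof -
  obtain v where v: "\<alpha> = elt a v \<rho>" "indec v"
    using indec_of_indecomposable[OF assms(1,2)] .
  note bound = point_norm_le[OF a_ge assms(3,4)]
  \<comment> \<open>The corner \<open>k = 0\<close>, \<open>y = m\<close> is the unit
    \<open>r*(r - a)^2\<close>, so the bound on the rectangle also covers the norm 1 of the
    vertices.\<close>
  have "point_norm a m 0 m = 1" unfolding point_norm_def by (simp add: polynomial_expand)
  then have one: "1 \<le> point_norm a m (a - 1) (L + 1)" using bound[of 0 m] a_ge m_ge by simp
  obtain n where "nrm v = of_int n" "n \<le> point_norm a m (a - 1) (L + 1)"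
    using indec_reduced_norm[OF v(2)] unfolding reduced_norm_def
  proof (elim disjE exE conjE)
    assume "nrm v = 1"
    then show ?thesis using that[of 1] one by simp
  qed (use that bound in blast)
  then show ?thesis unfolding v(1) by (simp add: field_norm_elt[OF assms(1)])
qed

end

section \<open>Existence of the three real roots, and the conclusion\<close>

lemma exists_cubic_roots:
  fixes a m :: int
  assumes "2 \<le> a" "2 \<le> m"
  obtains r1 r2 r3 where "cubic_roots a m r1 r2 r3"
proof -
  define A B :: real where "A = a" and "B = of_int (a + m)"
  have AB: "2 \<le> A" "A + 2 \<le> B" using assms by (simp_all add: A_def B_def)
  \<comment> \<open>\<open>f\<close> vanishes at 0, \<open>A\<close>, \<open>B\<close> and exceeds 1
    at \<open>1 / A\<close>, \<open>A - 1\<close>, \<open>B + 1\<close>; the intermediate value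
    theorem gives a solution of \<open>f x = 1\<close> in each of the three intervals.\<close>
  define f where "f x = x * (x - A) * (x - B)" for x
  have cont: "continuous_on S f" for S unfolding f_def by (intro continuous_intros)
  have f0: "f 0 = 0" "f A = 0" "f B = 0" by (simp_all add: f_def)
  have "1 < f (1 / A)"
  proof -
    have "1 / A \<le> 1 / 2" using AB by (simp add: field_simps)
    then have "A * 1 < (B - 1 / A) * (A - 1 / A)"
      using AB by (intro mult_strict_mono) linarith+
    then show ?thesis using AB unfolding f_def by (simp add: field_simps)
  qed
  have "1 < f (A - 1)"
    using mult_strict_mono[of 1 "B - A + 1" 1 "A - 1"] mult_mono[of 1 "A - 1" 2 "B - A + 1"] AB
    unfolding f_def by (simp add: algebra_simps)
  have "1 < f (B + 1)"
    using mult_mono[of 4 "B + 1" 2 "B - A + 1"] AB unfolding f_def by (simp add: algebra_simps)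
  obtain r1 where r1: "0 \<le> r1" "r1 \<le> 1 / A" "f r1 = 1"
    using IVT'[of f 0 1 "1 / A"] cont f0 \<open>1 < f (1 / A)\<close> AB by auto
  obtain r2 where r2: "A - 1 \<le> r2" "r2 \<le> A" "f r2 = 1"
    using IVT2'[of f A 1 "A - 1"] cont f0 \<open>1 < f (A - 1)\<close> AB by auto
  obtain r3 where r3: "B \<le> r3" "f r3 = 1"
    using IVT'[of f B 1 "B + 1"] cont f0 \<open>1 < f (B + 1)\<close> AB by auto
  have "r1 \<noteq> 0" "r1 \<noteq> 1 / A" "r2 \<noteq> A - 1" "r2 \<noteq> A" "r3 \<noteq> B"
    using r1 r2 r3 f0 \<open>1 < f (1 / A)\<close> \<open>1 < f (A - 1)\<close> by auto
  then have "0 < r1" "A * r1 < 1" "A - 1 < r2" "r2 < A" "B < r3"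
    using r1 r2 r3 AB by (auto simp: field_simps)
  then have "cubic_roots a m r1 r2 r3"
    using assms r1(3) r2(3) r3(2) unfolding f_def
    by unfold_locales (auto simp: is_root_def A_def B_def)
  then show ?thesis by (rule that)
qed

theorem proposition5p8:
  fixes a b L l0 :: int and \<rho> \<alpha> :: "'a::field_char_0"
  assumes "2 \<le> a" and "a \<le> b - 2" and "(a, b) \<noteq> (2, 4)"
    and "poly [:- 1, of_int (a * b), - of_int (a + b), 1:] \<rho> = 0"
    and "b - a = 2 * L + l0" and "l0 \<in> {0, 1}"
    and "indecomposable_in (rat_adjoin \<rho>) (int_adjoin \<rho>) \<alpha>"
  shows "(l0 = 0 \<and> 1 \<le> L \<and> L \<le> a - 2 \<longrightarrow>
           field_norm (rat_adjoin \<rho>) \<alpha> \<le>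
             of_int (L^2 * a^3 + (2 * L^3 + L^2 + 1) * a^2 - (2 * L^3 + 3 * L^2 + L) * a
                     + L^3 + L^2)) \<and>
         (l0 = 1 \<and> 1 \<le> L \<and> L \<le> a + 1 \<longrightarrow>
           field_norm (rat_adjoin \<rho>) \<alpha> \<le>
             of_int ((L^2 + L) * a^3 + (2 * L^3 + 4 * L^2 + 3 * L + 3) * a^2
                     - (2 * L^3 + 6 * L^2 + 5 * L + 3) * a + L^3 + 3 * L^2 + 2 * L + 1))"
proof -
  define m where "m = b - a"
  have m: "2 \<le> m" "b = a + m" using assms(2) by (simp_all add: m_def)
  have rho: "is_root a m \<rho>"
    using assms(4) unfolding is_root_def m(2) by (simp add: algebra_simps)
  obtain r1 r2 r3 where "cubic_roots a m r1 r2 r3"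
    using exists_cubic_roots[OF assms(1) m(1)] .
  then interpret cubic_roots a m r1 r2 r3 .
  note bound = norm_indecomposable_le[OF rho assms(7)]
  show ?thesis
  proof (intro conjI impI)
    assume "l0 = 0 \<and> 1 \<le> L \<and> L \<le> a - 2"
    then have L: "m = 2 * L" "1 \<le> L" "L \<le> a - 2" using assms(5) by (simp_all add: m_def)
    have "point_norm a m (a - 1) (L + 1) =
        L^2 * a^3 + (2 * L^3 + L^2 + 1) * a^2 - (2 * L^3 + 3 * L^2 + L) * a + L^3 + L^2"
      unfolding point_norm_def L(1) by algebra
    then show "field_norm (rat_adjoin \<rho>) \<alpha> \<le> of_int (L^2 * a^3 + (2 * L^3 + L^2 + 1) * a^2
        - (2 * L^3 + 3 * L^2 + L) * a + L^3 + L^2)"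
      using bound[of L] L by metis
  next
    assume "l0 = 1 \<and> 1 \<le> L \<and> L \<le> a + 1"
    then have L: "m = 2 * L + 1" "1 \<le> L" "L \<le> a + 1" using assms(5) by (simp_all add: m_def)
    have "point_norm a m (a - 1) (L + 1) =
        (L^2 + L) * a^3 + (2 * L^3 + 4 * L^2 + 3 * L + 3) * a^2
          - (2 * L^3 + 6 * L^2 + 5 * L + 3) * a + L^3 + 3 * L^2 + 2 * L + 1"
      unfolding point_norm_def L(1) by algebra
    then show "field_norm (rat_adjoin \<rho>) \<alpha> \<le> of_int ((L^2 + L) * a^3
        + (2 * L^3 + 4 * L^2 + 3 * L + 3) * a^2
        - (2 * L^3 + 6 * L^2 + 5 * L + 3) * a + L^3 + 3 * L^2 + 2 * L + 1)"
      using bound[of L] L by metis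
  qed
qed

end
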